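(* If $B$ is an interpolating Blaschke product with (infinite) zero sequence $\{a_k\}_{k\ge1}$ contained in the interval $(0,1)$, then the operator $T_B$ is unbounded on $H^\infty$; that is, $T_B$ is not a bounded operator from $H^\infty$ into $H^\infty$.
   Context: $\mathbb{D}$ is the open unit disk and $H^\infty$ is the Banach space of bounded analytic functions on $\mathbb{D}$ with the supremum norm. For $g$ analytic on $\mathbb{D}$, $T_gf(z)=\int_0^z f(t)g'(t)\,dt$, $z\in\mathbb{D}$. The Blaschke product with zero sequence $\{a_k\}\subseteq\mathbb{D}\setminus\{0\}$, where $\sum_k(1-|a_k|)<\infty$, is $B(z)=\prod_k\frac{|a_k|}{a_k}\frac{a_k-z}{1-\overline{a_k}z}$. It is called interpolating if $\{a_k\}$ is an interpolating sequence for $H^\infty$ (for every bounded complex sequence $\{w_k\}$ there is $f\in H^\infty$ with $f(a_k)=w_k$ for all $k$); equivalently, there exists $\delta>0$ such that $\prod_{j\ne k}\left|\frac{a_j-a_k}{1-\overline{a_j}a_k}\right|\ge\delta$ for all $k\ge1$. *)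

theory Defs
  imports "HOL-Complex_Analysis.Complex_Analysis"
begin

text \<open>Functions on the unit disk are represented by total functions on \<open>complex\<close>;
  their values outside \<open>ball 0 1\<close> are irrelevant in every definition below.\<close>

definition Hinf :: "(complex \<Rightarrow> complex) set" where
  "Hinf = {f. f holomorphic_on ball 0 1 \<and> bounded (f ` ball 0 1)}"

text \<open>The supremum is over a real set, so it is the actual supremum only when the function
  is bounded on the disk, e.g. for members of \<open>Hinf\<close>.\<close>

definition Hinf_norm :: "(complex \<Rightarrow> complex) \<Rightarrow> real" where
  "Hinf_norm f = (SUP z\<in>ball 0 1. norm (f z))"

text \<open>The integral from \<open>0\<close> to \<open>z\<close> is taken along the segment; for holomorphic \<open>f\<close>
  and \<open>g\<close> on the disk it does not depend on the path.\<close>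

definition volterra :: "(complex \<Rightarrow> complex) \<Rightarrow> (complex \<Rightarrow> complex) \<Rightarrow> complex \<Rightarrow> complex" where
  "volterra g f z = contour_integral (linepath 0 z) (\<lambda>t. f t * deriv g t)"

text \<open>Membership of \<open>T f\<close> in \<open>Hinf\<close> is part of the definition, so an operator that does
  not map \<open>Hinf\<close> into itself is not bounded.\<close>

definition bounded_on_Hinf :: "((complex \<Rightarrow> complex) \<Rightarrow> complex \<Rightarrow> complex) \<Rightarrow> bool" where
  "bounded_on_Hinf T \<longleftrightarrow>
     (\<forall>f\<in>Hinf. T f \<in> Hinf) \<and> (\<exists>C. \<forall>f\<in>Hinf. Hinf_norm (T f) \<le> C * Hinf_norm f)"

definition blaschke_sequence :: "(nat \<Rightarrow> complex) \<Rightarrow> bool" where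
  "blaschke_sequence a \<longleftrightarrow> range a \<subseteq> ball 0 1 - {0} \<and> summable (\<lambda>k. 1 - norm (a k))"

text \<open>The library's infinite product admits finitely many vanishing factors, so this is
  meaningful, with value \<open>0\<close>, also at the points of the sequence.\<close>

definition blaschke_product :: "(nat \<Rightarrow> complex) \<Rightarrow> complex \<Rightarrow> complex" where
  "blaschke_product a z =
     (\<Prod>k. of_real (norm (a k)) / a k * ((a k - z) / (1 - cnj (a k) * z)))"

definition interpolating_sequence :: "(nat \<Rightarrow> complex) \<Rightarrow> bool" where
  "interpolating_sequence a \<longleftrightarrow>
     range a \<subseteq> ball 0 1 \<and>
     (\<forall>w :: nat \<Rightarrow> complex. bounded (range w) \<longrightarrow> (\<exists>f\<in>Hinf. \<forall>k. f (a k) = w k))"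

end

theory Submission
  imports Defs
begin

text \<open>
  Write \<open>B\<close> for the product and \<open>F\<^sub>k = (1 - \<psi>\<^sub>k\<^sup>2)\<^bsup>N\<^esup>\<close> with
  \<open>\<psi>\<^sub>k(z) = (z - a\<^sub>k) / (1 - a\<^sub>k z)\<close>. On the interval \<open>(-1, 1)\<close> the function
  \<open>F\<^sub>k\<close> is a positive peak at \<open>a\<^sub>k\<close>, of width about \<open>1 / sqrt N\<close> in the hyperbolic metric.
  Three facts make finite sums \<open>f = (\<Sum>k. \<epsilon>\<^sub>k F\<^sub>k)\<close> with unimodular \<open>\<epsilon>\<^sub>k\<close>
  into test functions on which the operator is arbitrarily large.

  First, the points \<open>a\<^sub>k\<close> approach 1 geometrically. A bounded function with value \<open>(-1)^n\<close> at
  the \<open>n\<close>-th smallest point changes by 2 between neighbours, while Cauchy's estimate bounds its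
  derivative by \<open>K / (1 - t)\<close>; hence \<open>1 - a\<^sub>k\<close> shrinks at least by a fixed factor
  \<open>q < 1\<close> from each point to the next (\<open>interpolating_real_geometric_decay\<close>). This has two
  consequences. The products of pseudohyperbolic distances from \<open>a\<^sub>k\<close> to the other points stay
  above some \<open>P > 0\<close>, so that \<open>(1 - a\<^sub>k\<^sup>2) |B'(a\<^sub>k)| \<ge> P\<close> for all \<open>k\<close>
  (\<open>prod_quotient_lower_bound\<close>, \<open>blaschke_product_deriv_zero_ge\<close>). And
  \<open>(\<Sum>k. |F\<^sub>k|)\<close> is bounded on the disk, because \<open>|F\<^sub>k(z)|\<close> is at most a constant times
  the smaller of \<open>(1 - a\<^sub>k) / |1 - z|\<close> and its inverse
  (\<open>norm_peak_le\<close>, \<open>sum_min_ratio_le\<close>). So the norm of \<open>f\<close> is bounded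
  independently of the number of summands.

  Second, each peak picks up a fixed amount of \<open>B'\<close>. The substitution \<open>\<zeta> = \<psi>\<^sub>k(z)\<close> turns
  \<open>\<integral> F\<^sub>k B' dz\<close> into \<open>\<integral> (1 - \<zeta>\<^sup>2)\<^bsup>N\<^esup> g'(\<zeta>) d\<zeta>\<close>, where \<open>g\<close> is \<open>B\<close> composed
  with the inverse of \<open>\<psi>\<^sub>k\<close>. Since \<open>|g| \<le> 1\<close>, Cauchy's estimates control the difference of
  \<open>g'(\<zeta>)\<close> and \<open>g'(0)\<close>. With \<open>N = m\<^sup>2\<close> the kernel has mass at least
  \<open>4 / (3 m)\<close> near 0, whereas the difference contributes at most \<open>8 / (m\<^sup>2 - 1)\<close>
  (\<open>kernel_integral_deriv_ge\<close>). As \<open>|g'(0)| = (1 - a\<^sub>k\<^sup>2) |B'(a\<^sub>k)| \<ge> P\<close>, a large \<open>m\<close>,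
  the same for all \<open>k\<close>, gives a lower bound \<open>c > 0\<close> for the absolute value of the integral over \<open>[0, \<rho>]\<close>
  once \<open>\<rho>\<close> is close enough to 1 (\<open>peak_integral_ge\<close>).

  Third, if \<open>\<epsilon>\<^sub>k\<close> rotates the \<open>k\<close>-th integral to the positive axis, then \<open>n\<close> summands make the image
  of \<open>f\<close> at least \<open>n c\<close> at \<open>\<rho>\<close>, which no bound on the operator survives as \<open>n\<close> grows.
\<close>

section \<open>Products and sums over a geometrically decaying family\<close>

text \<open>The full product of \<open>(1 - q ^ m) / (1 + q ^ m)\<close> over \<open>m > 0\<close> converges to a positive number, and
  its factors are below 1, so passing to any finite set of distinct exponents can only increase it.\<close>

lemma prod_geometric_lower_bound:
  fixes q :: real
  assumes "0 < q" "q < 1"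
  obtains P where "0 < P"
    "\<And>(h :: nat \<Rightarrow> nat) J. finite J \<Longrightarrow> inj_on h J \<Longrightarrow> (\<And>j. j \<in> J \<Longrightarrow> 0 < h j) \<Longrightarrow>
       P \<le> (\<Prod>j\<in>J. (1 - q ^ h j) / (1 + q ^ h j))"
proof -
  define c where "c m = (1 - q ^ Suc m) / (1 + q ^ Suc m)" for m
  have qm: "0 < q ^ m" for m using assms by simp
  have qm1: "q ^ Suc m < 1" for m using assms power_Suc_less_one by blast
  have cpos: "0 < c m" for m using qm[of "Suc m"] qm1[of m] by (simp add: c_def add_pos_pos)
  have cle: "c m \<le> 1" for m using qm[of "Suc m"] by (simp add: c_def)
  have sum: "summable (\<lambda>m. norm (c m - 1))"
  proof (rule summable_comparison_test)
    have "norm (norm (c m - 1)) \<le> 2 * q ^ m" for m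
    proof -
      have "c m - 1 = - (2 * q ^ Suc m / (1 + q ^ Suc m))"
        using qm[of "Suc m"] by (simp add: c_def field_simps del: power_Suc)
      then have "norm (c m - 1) = 2 * q ^ Suc m / (1 + q ^ Suc m)"
        using qm[of "Suc m"] by (simp del: power_Suc)
      also have "\<dots> \<le> 2 * q ^ Suc m" using qm[of "Suc m"] by (simp add: field_simps del: power_Suc)
      also have "\<dots> \<le> 2 * q ^ m" using assms by simp
      finally show ?thesis by simp
    qed
    then show "\<exists>N. \<forall>n\<ge>N. norm (norm (c n - 1)) \<le> 2 * q ^ n" by blast
    show "summable (\<lambda>n. 2 * q ^ n)" using assms by (intro summable_mult summable_geometric) auto
  qed
  have conv: "convergent_prod c"
    using summable_imp_abs_convergent_prod[OF sum] abs_convergent_prod_imp_convergent_prod by blast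
  have P: "0 < prodinf c" using less_0_prodinf[OF conv cpos] .
  show thesis
  proof
    show "0 < prodinf c" by fact
    fix h :: "nat \<Rightarrow> nat" and J
    assume J: "finite J" "inj_on h J" "\<And>j. j \<in> J \<Longrightarrow> 0 < h j"
    define g where "g j = h j - 1" for j
    have inj: "inj_on g J"
      using J unfolding inj_on_def g_def by (metis Suc_pred' Suc_diff_1)
    obtain N where N: "g ` J \<subseteq> {..<N}" using J(1) finite_nat_iff_bounded by blast
    have "prodinf c \<le> (\<Prod>m<N. c m)"
      using prod_ge_prodinf[OF convergent_prod_has_prod[OF conv]] cpos cle less_imp_le by metis
    also have "\<dots> \<le> (\<Prod>m\<in>g ` J. c m)"
    proof -
      have "(\<Prod>m<N. c m) = (\<Prod>m\<in>{..<N} - g ` J. c m) * (\<Prod>m\<in>g ` J. c m)"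
        using N by (simp add: prod.subset_diff)
      also have "\<dots> \<le> 1 * (\<Prod>m\<in>g ` J. c m)"
        using cpos cle by (intro mult_right_mono prod_le_1 prod_nonneg) (auto intro: less_imp_le)
      finally show ?thesis by simp
    qed
    also have "\<dots> = (\<Prod>j\<in>J. c (g j))" using inj by (simp add: prod.reindex)
    also have "\<dots> = (\<Prod>j\<in>J. (1 - q ^ h j) / (1 + q ^ h j))"
      by (rule prod.cong) (use J(3) in \<open>auto simp: c_def g_def simp del: power_Suc\<close>)
    finally show "prodinf c \<le> (\<Prod>j\<in>J. (1 - q ^ h j) / (1 + q ^ h j))" .
  qed
qed

lemma sum_power_inj_le:
  fixes q :: real
  assumes "0 < q" "q < 1" "finite S" "inj_on h S"
  shows "(\<Sum>k\<in>S. q ^ h k) \<le> 1 / (1 - q)"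
proof -
  have "(\<Sum>k\<in>S. q ^ h k) = (\<Sum>m\<in>h ` S. q ^ m)" using assms by (simp add: sum.reindex)
  also have "\<dots> \<le> (\<Sum>m. q ^ m)"
    by (rule sum_le_suminf) (use assms in \<open>auto intro: summable_geometric\<close>)
  also have "\<dots> = 1 / (1 - q)" using assms by (simp add: suminf_geometric)
  finally show ?thesis .
qed

text \<open>Later \<open>x k\<close> is the distance from the \<open>k\<close>-th zero to 1 and \<open>r k\<close> is the number of zeros to the
  left of it. Carrying the rank along avoids reordering the sequence, and with it the infinite product.\<close>

locale geometric_decay =
  fixes q :: real and x :: "nat \<Rightarrow> real" and r :: "nat \<Rightarrow> nat"
  assumes q: "0 < q" "q < 1"
    and x_pos: "0 < x k"
    and r_inj: "inj r"
    and decay: "r k \<le> r j \<Longrightarrow> x j \<le> q ^ (r j - r k) * x k"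
begin

text \<open>A pair of ranks at distance \<open>n\<close> contributes at least \<open>(1 - q ^ n) / (1 + q ^ n)\<close>. On each
  side of \<open>k\<close> every distance occurs at most once, so each side contributes at least the constant of
  the preceding product.\<close>

lemma prod_quotient_lower_bound:
  obtains P where "0 < P"
    "\<And>k J. finite J \<Longrightarrow> k \<notin> J \<Longrightarrow> P \<le> (\<Prod>j\<in>J. \<bar>x j - x k\<bar> / (x j + x k))"
proof -
  obtain P where P: "0 < P" and PJ:
    "\<And>(h :: nat \<Rightarrow> nat) J. finite J \<Longrightarrow> inj_on h J \<Longrightarrow> (\<And>j. j \<in> J \<Longrightarrow> 0 < h j) \<Longrightarrow>
       P \<le> (\<Prod>j\<in>J. (1 - q ^ h j) / (1 + q ^ h j))"
    using prod_geometric_lower_bound[OF q] by metis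
  have key: "(1 - q ^ m) / (1 + q ^ m) \<le> \<bar>u - v\<bar> / (u + v)"
    if "u \<le> q ^ m * v" "0 < u" "0 < v" for u v m
  proof -
    have "(1 - q ^ m) / (1 + q ^ m) \<le> (v - u) / (u + v)"
    proof -
      have "0 < 1 + q ^ m" using q by (simp add: add_pos_pos)
      then show ?thesis using that by (simp add: divide_simps) (simp add: algebra_simps)
    qed
    also have "\<dots> \<le> \<bar>u - v\<bar> / (u + v)" using that by (intro divide_right_mono) auto
    finally show ?thesis .
  qed
  have nonneg: "0 \<le> (1 - q ^ m) / (1 + q ^ m)" for m
    using q by (simp add: power_le_one add_pos_pos)
  show thesis
  proof
    show "0 < P * P" using P by simp
    fix k J assume J: "finite (J :: nat set)" "k \<notin> J"
    define J1 where "J1 = {j\<in>J. r k < r j}"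
    define J2 where "J2 = {j\<in>J. r j < r k}"
    have "r j \<noteq> r k" if "j \<in> J" for j using that J(2) r_inj by (metis inj_eq)
    then have split: "J = J1 \<union> J2" "J1 \<inter> J2 = {}" "finite J1" "finite J2"
      using J(1) by (auto simp: J1_def J2_def linorder_neq_iff)
    have inj1: "inj_on (\<lambda>j. r j - r k) J1"
    proof (rule inj_onI)
      fix i j assume "i \<in> J1" "j \<in> J1" "r i - r k = r j - r k"
      then have "r i = r j" unfolding J1_def by auto
      then show "i = j" using r_inj by (simp add: inj_eq)
    qed
    have inj2: "inj_on (\<lambda>j. r k - r j) J2"
    proof (rule inj_onI)
      fix i j assume "i \<in> J2" "j \<in> J2" "r k - r i = r k - r j"
      then have "r i = r j" unfolding J2_def by auto
      then show "i = j" using r_inj by (simp add: inj_eq)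
    qed
    have "P \<le> (\<Prod>j\<in>J1. (1 - q ^ (r j - r k)) / (1 + q ^ (r j - r k)))"
      by (rule PJ[OF split(3) inj1]) (simp add: J1_def)
    also have "\<dots> \<le> (\<Prod>j\<in>J1. \<bar>x j - x k\<bar> / (x j + x k))"
      by (intro prod_mono conjI nonneg key) (auto simp: J1_def x_pos intro!: decay)
    finally have 1: "P \<le> (\<Prod>j\<in>J1. \<bar>x j - x k\<bar> / (x j + x k))" .
    have "P \<le> (\<Prod>j\<in>J2. (1 - q ^ (r k - r j)) / (1 + q ^ (r k - r j)))"
      by (rule PJ[OF split(4) inj2]) (simp add: J2_def)
    also have "\<dots> \<le> (\<Prod>j\<in>J2. \<bar>x k - x j\<bar> / (x k + x j))"
      by (intro prod_mono conjI nonneg key) (auto simp: J2_def x_pos intro!: decay)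
    also have "\<dots> = (\<Prod>j\<in>J2. \<bar>x j - x k\<bar> / (x j + x k))"
      by (simp add: abs_minus_commute add.commute)
    finally have 2: "P \<le> (\<Prod>j\<in>J2. \<bar>x j - x k\<bar> / (x j + x k))" .
    have "P * P \<le> (\<Prod>j\<in>J1. \<bar>x j - x k\<bar> / (x j + x k)) * (\<Prod>j\<in>J2. \<bar>x j - x k\<bar> / (x j + x k))"
      using 1 2 P by (intro mult_mono) auto
    also have "\<dots> = (\<Prod>j\<in>J. \<bar>x j - x k\<bar> / (x j + x k))"
      by (subst split(1), rule prod.union_disjoint[OF split(3,4,2), symmetric])
    finally show "P * P \<le> (\<Prod>j\<in>J. \<bar>x j - x k\<bar> / (x j + x k))" .
  qed
qed

text \<open>The terms are at most 1 and decay geometrically with the rank on both sides of the scale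
  \<open>d\<close>: each side is compared with a geometric series starting at its element closest to \<open>d\<close>.\<close>

lemma sum_min_ratio_le:
  assumes S: "finite S" and d: "0 < d"
  shows "(\<Sum>k\<in>S. min (x k / d) (d / x k)) \<le> 2 / (1 - q)"
proof -
  define S1 where "S1 = {k\<in>S. x k \<le> d}"
  define S2 where "S2 = {k\<in>S. d < x k}"
  have split: "S = S1 \<union> S2" "S1 \<inter> S2 = {}" "finite S1" "finite S2"
    using S by (auto simp: S1_def S2_def)
  have 1: "(\<Sum>k\<in>S1. min (x k / d) (d / x k)) \<le> 1 / (1 - q)"
  proof (cases "S1 = {}")
    case False
    obtain k0 where k0: "k0 \<in> S1" "\<And>k. k \<in> S1 \<Longrightarrow> r k0 \<le> r k"
      using arg_min_if_finite[OF split(3) False, of r] by (metis linorder_not_le)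
    have "(\<Sum>k\<in>S1. min (x k / d) (d / x k)) \<le> (\<Sum>k\<in>S1. q ^ (r k - r k0))"
    proof (rule sum_mono)
      fix k assume "k \<in> S1"
      then have "x k \<le> q ^ (r k - r k0) * x k0" using decay k0 by blast
      also have "\<dots> \<le> q ^ (r k - r k0) * d" using k0(1) q by (simp add: S1_def)
      finally show "min (x k / d) (d / x k) \<le> q ^ (r k - r k0)"
        using d by (simp add: min_le_iff_disj divide_le_eq)
    qed
    also have "\<dots> \<le> 1 / (1 - q)"
    proof (rule sum_power_inj_le[OF q split(3)])
      show "inj_on (\<lambda>k. r k - r k0) S1"
      proof (rule inj_onI)
        fix k l assume kl: "k \<in> S1" "l \<in> S1" "r k - r k0 = r l - r k0"
        then have "r k = r l" using k0(2)[of k] k0(2)[of l] by linarith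
        then show "k = l" using r_inj by (simp add: inj_eq)
      qed
    qed
    finally show ?thesis .
  qed (use q in auto)
  have 2: "(\<Sum>k\<in>S2. min (x k / d) (d / x k)) \<le> 1 / (1 - q)"
  proof (cases "S2 = {}")
    case False
    obtain k1 where k1: "k1 \<in> S2" "\<And>k. k \<in> S2 \<Longrightarrow> r k \<le> r k1"
      using Max_in[of "r ` S2"] Max_ge[of "r ` S2"] split(4) False
      by (smt (verit) empty_is_image finite_imageI imageE imageI)
    have "(\<Sum>k\<in>S2. min (x k / d) (d / x k)) \<le> (\<Sum>k\<in>S2. q ^ (r k1 - r k))"
    proof (rule sum_mono)
      fix k assume "k \<in> S2"
      have "d \<le> x k1" using k1(1) by (simp add: S2_def)
      also have "\<dots> \<le> q ^ (r k1 - r k) * x k" using decay k1(2) \<open>k \<in> S2\<close> by blast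
      finally show "min (x k / d) (d / x k) \<le> q ^ (r k1 - r k)"
        using x_pos[of k] by (simp add: min_le_iff_disj divide_le_eq)
    qed
    also have "\<dots> \<le> 1 / (1 - q)"
    proof (rule sum_power_inj_le[OF q split(4)])
      show "inj_on (\<lambda>k. r k1 - r k) S2"
      proof (rule inj_onI)
        fix k l assume kl: "k \<in> S2" "l \<in> S2" "r k1 - r k = r k1 - r l"
        then have "r k = r l" using k1(2)[of k] k1(2)[of l] by linarith
        then show "k = l" using r_inj by (simp add: inj_eq)
      qed
    qed
    finally show ?thesis .
  qed (use q in auto)
  have "(\<Sum>k\<in>S. min (x k / d) (d / x k)) =
      (\<Sum>k\<in>S1. min (x k / d) (d / x k)) + (\<Sum>k\<in>S2. min (x k / d) (d / x k))"
    by (subst split(1), rule sum.union_disjoint[OF split(3,4,2)])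
  then show ?thesis using 1 2 by simp
qed

end

section \<open>Integrating a derivative against a concentrating kernel\<close>

text \<open>Cauchy's inequality applies on circles inside the disk only; the bound with the full
  distance to the boundary is their limit.\<close>

lemma Cauchy_bound_unit_disk:
  assumes hol: "f holomorphic_on ball 0 1"
    and bd: "\<And>z. z \<in> ball 0 1 \<Longrightarrow> norm (f z) \<le> K"
    and z: "norm z < 1"
  shows "norm ((deriv ^^ n) f z) \<le> fact n * K / (1 - norm z) ^ n"
proof -
  define R where "R = 1 - norm z"
  have R: "0 < R" using z by (simp add: R_def)
  have bound: "norm ((deriv ^^ n) f z) * \<rho> ^ n \<le> fact n * K" if \<rho>: "0 < \<rho>" "\<rho> < R" for \<rho>
  proof -
    have sub: "cball z \<rho> \<subseteq> ball 0 1"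
    proof
      fix w assume "w \<in> cball z \<rho>"
      then have "norm w \<le> norm z + \<rho>"
        by (metis add.commute diff_le_eq dist_commute dist_norm mem_cball norm_triangle_ineq2 order_trans)
      then show "w \<in> ball 0 1" using \<rho> by (simp add: R_def)
    qed
    have "norm ((deriv ^^ n) f z) \<le> fact n * K / \<rho> ^ n"
    proof (rule Cauchy_inequality)
      show "f holomorphic_on ball z \<rho>"
        using hol sub ball_subset_cball holomorphic_on_subset by blast
      show "continuous_on (cball z \<rho>) f"
        using hol sub holomorphic_on_imp_continuous_on holomorphic_on_subset by blast
      fix w assume "norm (z - w) = \<rho>"
      then have "w \<in> ball 0 1" using sub by (auto simp: dist_norm)
      then show "norm (f w) \<le> K" by (rule bd)
    qed fact
    then show ?thesis using \<rho> by (simp add: field_simps)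
  qed
  have "((\<lambda>\<rho>. norm ((deriv ^^ n) f z) * \<rho> ^ n) \<longlongrightarrow> norm ((deriv ^^ n) f z) * R ^ n) (at_left R)"
    by (intro tendsto_intros)
  moreover have "\<forall>\<^sub>F \<rho> in at_left R. norm ((deriv ^^ n) f z) * \<rho> ^ n \<le> fact n * K"
    using eventually_at_left_real[OF R] by eventually_elim (auto intro: bound)
  ultimately have "norm ((deriv ^^ n) f z) * R ^ n \<le> fact n * K"
    by (rule tendsto_upperbound) simp
  then show ?thesis using R by (simp add: R_def field_simps)
qed

text \<open>The Cauchy bound for the second derivative, integrated from 0. The right-hand side is chosen so
  that two powers of the kernel \<open>1 - t\<^sup>2\<close> cancel its denominator and leave a function with an explicit
  primitive; this covers the points near the boundary together with those near 0.\<close>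

lemma deriv_diff_origin_bound:
  assumes hol: "g holomorphic_on ball 0 1"
    and bd: "\<And>z. z \<in> ball 0 1 \<Longrightarrow> norm (g z) \<le> 1"
    and z: "norm z < 1"
  shows "norm (deriv g z - deriv g 0) \<le> 8 * norm z / (1 - (norm z)\<^sup>2)\<^sup>2"
proof -
  have hol': "deriv g holomorphic_on ball 0 1"
    using hol by (intro holomorphic_deriv) auto
  have "norm (deriv g z - deriv g 0) \<le> 2 / (1 - norm z)\<^sup>2 * norm (z - 0)"
  proof (rule field_differentiable_bound[where S = "cball 0 (norm z)" and f' = "deriv (deriv g)"])
    fix w assume w: "w \<in> cball (0::complex) (norm z)"
    then have w1: "norm w < 1" using z by simp
    show "(deriv g has_field_derivative deriv (deriv g) w) (at w within cball 0 (norm z))"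
      using holomorphic_derivI[OF hol' open_ball, of w] w1 has_field_derivative_at_within by auto
    have "norm ((deriv ^^ 2) g w) \<le> fact 2 * 1 / (1 - norm w) ^ 2"
      by (rule Cauchy_bound_unit_disk[OF hol bd w1])
    also have "\<dots> \<le> 2 / (1 - norm z)\<^sup>2"
      using w z w1 by (auto intro!: divide_left_mono power_mono mult_pos_pos)
    finally show "norm (deriv (deriv g) w) \<le> 2 / (1 - norm z)\<^sup>2"
      by (simp add: numeral_2_eq_2)
  qed auto
  also have "2 / (1 - norm z)\<^sup>2 * norm (z - 0) = 2 * norm z / (1 - norm z)\<^sup>2" by simp
  also have "\<dots> \<le> 8 * norm z / (1 - (norm z)\<^sup>2)\<^sup>2"
  proof -
    have sq: "(norm z)\<^sup>2 < 1" using z by (simp add: power_less_one_iff)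
    have "1 - (norm z)\<^sup>2 \<le> 2 * (1 - norm z)"
    proof -
      have "0 \<le> (1 - norm z)\<^sup>2" by simp
      then show ?thesis by (simp add: power2_diff)
    qed
    then have "(1 - (norm z)\<^sup>2)\<^sup>2 \<le> (2 * (1 - norm z))\<^sup>2" using sq by (intro power_mono) auto
    also have "\<dots> = 4 * (1 - norm z)\<^sup>2" by (simp only: power_mult_distrib) simp
    finally have le: "(1 - (norm z)\<^sup>2)\<^sup>2 \<le> 4 * (1 - norm z)\<^sup>2" .
    have "2 * norm z / (1 - norm z)\<^sup>2 = 8 * norm z / (4 * (1 - norm z)\<^sup>2)" by simp
    also have "\<dots> \<le> 8 * norm z / (1 - (norm z)\<^sup>2)\<^sup>2"
      using le sq z by (intro divide_left_mono mult_pos_pos) auto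
    finally show ?thesis .
  qed
  finally show ?thesis .
qed

lemma integral_abs_kernel_le:
  fixes \<alpha> \<beta> :: real
  assumes "-1 \<le> \<alpha>" "\<alpha> \<le> 0" "0 \<le> \<beta>" "\<beta> \<le> 1"
  shows "integral {\<alpha>..\<beta>} (\<lambda>t. \<bar>t\<bar> * (1 - t\<^sup>2) ^ n) \<le> 1 / (real n + 1)"
proof -
  define H where "H t = - ((1 - t\<^sup>2) ^ Suc n) / (2 * (real n + 1))" for t :: real
  have H: "(H has_real_derivative t * (1 - t\<^sup>2) ^ n) (at t within A)" for t A
    unfolding H_def by (rule derivative_eq_intros refl | simp)+ (simp add: field_simps)
  have pos: "((\<lambda>t. \<bar>t\<bar> * (1 - t\<^sup>2) ^ n) has_integral H \<beta> - H 0) {0..\<beta>}"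
  proof (rule has_integral_eq)
    show "((\<lambda>t. t * (1 - t\<^sup>2) ^ n) has_integral H \<beta> - H 0) {0..\<beta>}"
      using H assms(3) by (intro fundamental_theorem_of_calculus)
        (auto simp flip: has_real_derivative_iff_has_vector_derivative)
  qed auto
  have neg: "((\<lambda>t. \<bar>t\<bar> * (1 - t\<^sup>2) ^ n) has_integral - (H 0 - H \<alpha>)) {\<alpha>..0}"
  proof (rule has_integral_eq)
    show "((\<lambda>t. - (t * (1 - t\<^sup>2) ^ n)) has_integral - (H 0 - H \<alpha>)) {\<alpha>..0}"
      using H assms(2) by (intro has_integral_neg fundamental_theorem_of_calculus)
        (auto simp flip: has_real_derivative_iff_has_vector_derivative)
  qed auto
  have "((\<lambda>t. \<bar>t\<bar> * (1 - t\<^sup>2) ^ n) has_integral - (H 0 - H \<alpha>) + (H \<beta> - H 0)) {\<alpha>..\<beta>}"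
    by (rule has_integral_combine[OF assms(2,3) neg pos])
  then have "integral {\<alpha>..\<beta>} (\<lambda>t. \<bar>t\<bar> * (1 - t\<^sup>2) ^ n) = - (H 0 - H \<alpha>) + (H \<beta> - H 0)"
    by (rule integral_unique)
  also have "\<dots> = 1 / (real n + 1) + H \<alpha> + H \<beta>"
  proof -
    have "- 2 * H 0 = 1 / (real n + 1)" by (simp add: H_def field_simps)
    then show ?thesis by linarith
  qed
  also have "\<dots> \<le> 1 / (real n + 1)"
  proof -
    have "H t \<le> 0" if "\<bar>t\<bar> \<le> 1" for t
    proof -
      have "t\<^sup>2 \<le> 1" using that by (simp add: abs_square_le_1)
      then show ?thesis unfolding H_def
        by (intro divide_nonpos_nonneg) (auto simp del: power_Suc)
    qed
    then show ?thesis using assms by (smt (verit))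
  qed
  finally show "integral {\<alpha>..\<beta>} (\<lambda>t. \<bar>t\<bar> * (1 - t\<^sup>2) ^ n) \<le> 1 / (real n + 1)" .
qed

text \<open>On \<open>[-1/m, 1/m]\<close> Bernoulli's inequality bounds the kernel below by \<open>1 - m\<^sup>2 t\<^sup>2\<close>. The exponent is
  a square so that the width of this interval is rational in \<open>m\<close>.\<close>

lemma integral_kernel_ge:
  fixes \<alpha> \<beta> :: real
  assumes "-1 \<le> \<alpha>" "\<alpha> \<le> -1/2" "1/2 \<le> \<beta>" "\<beta> \<le> 1" and m: "2 \<le> (m::nat)"
  shows "4 / (3 * real m) \<le> integral {\<alpha>..\<beta>} (\<lambda>t. (1 - t\<^sup>2) ^ m\<^sup>2)"
proof -
  define s where "s = 1 / real m"
  have s: "0 < s" "s \<le> 1/2" using m by (auto simp: s_def field_simps)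
  define H where "H t = t - (real m)\<^sup>2 * t ^ 3 / 3" for t :: real
  have "((\<lambda>t. 1 - (real m)\<^sup>2 * t\<^sup>2) has_integral H s - H (- s)) {-s..s}"
  proof (rule fundamental_theorem_of_calculus)
    fix t assume "t \<in> {-s..s}"
    have "(H has_real_derivative 1 - (real m)\<^sup>2 * t\<^sup>2) (at t within {-s..s})"
      unfolding H_def by (rule derivative_eq_intros refl | simp)+
    then show "(H has_vector_derivative 1 - (real m)\<^sup>2 * t\<^sup>2) (at t within {-s..s})"
      by (simp add: has_real_derivative_iff_has_vector_derivative)
  qed (use s in simp)
  moreover have "H s - H (- s) = 4 / (3 * real m)"
    using m by (simp add: H_def s_def field_simps power2_eq_square power3_eq_cube)
  ultimately have I: "((\<lambda>t. 1 - (real m)\<^sup>2 * t\<^sup>2) has_integral 4 / (3 * real m)) {-s..s}"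
    by simp
  have int: "(\<lambda>t. (1 - t\<^sup>2) ^ m\<^sup>2) integrable_on {u..v}" for u v :: real
    by (intro integrable_continuous_interval continuous_intros)
  have sq: "t\<^sup>2 \<le> 1" if "\<bar>t\<bar> \<le> 1" for t :: real using that by (simp add: abs_square_le_1)
  have "4 / (3 * real m) = integral {-s..s} (\<lambda>t. 1 - (real m)\<^sup>2 * t\<^sup>2)"
    using I by (simp add: integral_unique)
  also have "\<dots> \<le> integral {-s..s} (\<lambda>t. (1 - t\<^sup>2) ^ m\<^sup>2)"
  proof (rule integral_le[OF _ int])
    show "(\<lambda>t. 1 - (real m)\<^sup>2 * t\<^sup>2) integrable_on {-s..s}" using I by blast
    fix t assume "t \<in> {-s..s}"
    then have "t\<^sup>2 \<le> 1" using s by (intro sq) auto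
    then show "1 - (real m)\<^sup>2 * t\<^sup>2 \<le> (1 - t\<^sup>2) ^ m\<^sup>2"
      using Bernoulli_inequality[of "- t\<^sup>2" "m\<^sup>2"] by simp
  qed
  also have "\<dots> \<le> integral {\<alpha>..\<beta>} (\<lambda>t. (1 - t\<^sup>2) ^ m\<^sup>2)"
    by (rule integral_subset_le[OF _ int int])
      (use s assms in \<open>auto intro!: zero_le_power sq\<close>)
  finally show ?thesis .
qed

text \<open>For large \<open>m\<close> the kernel acts like a multiple of the point evaluation at 0: the main term
  is of order \<open>1 / m\<close>, the error of order \<open>1 / m\<^sup>2\<close>, uniformly over all \<open>g\<close> bounded by 1.\<close>

lemma kernel_integral_deriv_ge:
  fixes \<alpha> \<beta> :: real
  assumes hol: "g holomorphic_on ball 0 1"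
    and bd: "\<And>z. z \<in> ball 0 1 \<Longrightarrow> norm (g z) \<le> 1"
    and ab: "-1 < \<alpha>" "\<alpha> \<le> -1/2" "1/2 \<le> \<beta>" "\<beta> < 1" and m: "2 \<le> (m::nat)"
  shows "norm (deriv g 0) * 4 / (3 * real m) - 8 / (real m ^ 2 - 1)
    \<le> norm (contour_integral (linepath (of_real \<alpha>) (of_real \<beta>)) (\<lambda>z. (1 - z\<^sup>2) ^ m\<^sup>2 * deriv g z))"
proof -
  define k where "k t = (1 - t\<^sup>2) ^ m\<^sup>2" for t :: real
  define E where "E t = deriv g (of_real t) - deriv g 0" for t :: real
  have m2: "2 * 2 \<le> m * m" by (rule mult_le_mono[OF m m])
  have inball: "of_real t \<in> ball (0::complex) 1" if "t \<in> {\<alpha>..\<beta>}" for t :: real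
    using that ab by auto
  have cont': "continuous_on {\<alpha>..\<beta>} (\<lambda>t. deriv g (of_real t))"
  proof (rule continuous_on_compose2[of "ball 0 1" "deriv g"])
    show "continuous_on (ball 0 1) (deriv g)"
      using hol by (intro holomorphic_on_imp_continuous_on holomorphic_deriv) auto
  qed (use inball in \<open>auto intro!: continuous_intros\<close>)
  have intE: "(\<lambda>t. of_real (k t) * E t) integrable_on {\<alpha>..\<beta>}"
    unfolding k_def E_def by (intro integrable_continuous_interval continuous_intros cont')
  have intk: "k integrable_on {\<alpha>..\<beta>}"
    unfolding k_def by (intro integrable_continuous_interval continuous_intros)
  have "contour_integral (linepath (of_real \<alpha>) (of_real \<beta>)) (\<lambda>z. (1 - z\<^sup>2) ^ m\<^sup>2 * deriv g z)
      = integral {\<alpha>..\<beta>} (\<lambda>t. (1 - (of_real t)\<^sup>2) ^ m\<^sup>2 * deriv g (of_real t))"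
    using ab by (subst contour_integral_linepath_Reals_eq) auto
  also have "\<dots> = integral {\<alpha>..\<beta>} (\<lambda>t. of_real (k t) * deriv g 0 + of_real (k t) * E t)"
    by (simp add: k_def E_def algebra_simps)
  also have "\<dots> = integral {\<alpha>..\<beta>} (\<lambda>t. of_real (k t) * deriv g 0)
      + integral {\<alpha>..\<beta>} (\<lambda>t. of_real (k t) * E t)"
    by (rule integral_add[OF _ intE])
      (auto simp: k_def intro!: integrable_continuous_interval continuous_intros)
  also have "integral {\<alpha>..\<beta>} (\<lambda>t. of_real (k t) * deriv g 0)
      = of_real (integral {\<alpha>..\<beta>} k) * deriv g 0"
  proof -
    have "((\<lambda>t. complex_of_real (k t)) has_integral of_real (integral {\<alpha>..\<beta>} k)) {\<alpha>..\<beta>}"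
      using integrable_integral[OF intk] by (rule has_integral_of_real)
    then have "((\<lambda>t. of_real (k t) * deriv g 0) has_integral
        of_real (integral {\<alpha>..\<beta>} k) * deriv g 0) {\<alpha>..\<beta>}"
      by (rule has_integral_mult_left)
    then show ?thesis by (rule integral_unique)
  qed
  finally have eq: "contour_integral (linepath (of_real \<alpha>) (of_real \<beta>))
      (\<lambda>z. (1 - z\<^sup>2) ^ m\<^sup>2 * deriv g z) = of_real (integral {\<alpha>..\<beta>} k) * deriv g 0
      + integral {\<alpha>..\<beta>} (\<lambda>t. of_real (k t) * E t)" .
  have kge: "4 / (3 * real m) \<le> integral {\<alpha>..\<beta>} k"
    unfolding k_def using integral_kernel_ge[of \<alpha> \<beta> m] ab m by simp
  then have kge0: "0 \<le> integral {\<alpha>..\<beta>} k"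
    using m by (smt (verit) divide_nonneg_nonneg of_nat_0_le_iff)
  have "norm (integral {\<alpha>..\<beta>} (\<lambda>t. of_real (k t) * E t))
      \<le> integral {\<alpha>..\<beta>} (\<lambda>t. 8 * (\<bar>t\<bar> * (1 - t\<^sup>2) ^ (m\<^sup>2 - 2)))"
  proof (rule integral_norm_bound_integral[OF intE])
    show "(\<lambda>t. 8 * (\<bar>t\<bar> * (1 - t\<^sup>2) ^ (m\<^sup>2 - 2))) integrable_on {\<alpha>..\<beta>}"
      by (intro integrable_continuous_interval continuous_intros)
    fix t assume t: "t \<in> {\<alpha>..\<beta>}"
    then have "\<bar>t\<bar> < 1" using ab by auto
    then have t1: "0 < 1 - t\<^sup>2" by (simp add: abs_square_less_1)
    have "norm (E t) \<le> 8 * \<bar>t\<bar> / (1 - t\<^sup>2)\<^sup>2"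
      using deriv_diff_origin_bound[OF hol bd, of "of_real t"] inball[OF t] by (simp add: E_def)
    moreover have "k t = (1 - t\<^sup>2)\<^sup>2 * (1 - t\<^sup>2) ^ (m\<^sup>2 - 2)"
    proof -
      have "m\<^sup>2 = 2 + (m\<^sup>2 - 2)" using m2 by (simp add: power2_eq_square)
      then show ?thesis unfolding k_def by (metis power_add)
    qed
    ultimately show "norm (of_real (k t) * E t) \<le> 8 * (\<bar>t\<bar> * (1 - t\<^sup>2) ^ (m\<^sup>2 - 2))"
    proof -
      assume a: "norm (E t) \<le> 8 * \<bar>t\<bar> / (1 - t\<^sup>2)\<^sup>2"
        and kt: "k t = (1 - t\<^sup>2)\<^sup>2 * (1 - t\<^sup>2) ^ (m\<^sup>2 - 2)"
      have k0: "0 \<le> k t" using t1 by (simp add: k_def)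
      have "norm (of_real (k t) * E t) = k t * norm (E t)"
        using k0 by (simp add: norm_mult)
      also have "\<dots> \<le> k t * (8 * \<bar>t\<bar> / (1 - t\<^sup>2)\<^sup>2)"
        using a k0 by (rule mult_left_mono)
      also have "\<dots> = 8 * (\<bar>t\<bar> * (1 - t\<^sup>2) ^ (m\<^sup>2 - 2))"
        using t1 by (simp add: kt field_simps)
      finally show ?thesis .
    qed
  qed
  also have "\<dots> = 8 * integral {\<alpha>..\<beta>} (\<lambda>t. \<bar>t\<bar> * (1 - t\<^sup>2) ^ (m\<^sup>2 - 2))" by simp
  also have "\<dots> \<le> 8 * (1 / (real (m\<^sup>2 - 2) + 1))"
    using integral_abs_kernel_le[of \<alpha> \<beta> "m\<^sup>2 - 2"] ab by simp
  also have "\<dots> = 8 / (real m ^ 2 - 1)" using m2 by (simp add: of_nat_diff power2_eq_square)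
  finally have err: "norm (integral {\<alpha>..\<beta>} (\<lambda>t. of_real (k t) * E t)) \<le> 8 / (real m ^ 2 - 1)" .
  have "norm (deriv g 0) * 4 / (3 * real m) = 4 / (3 * real m) * norm (deriv g 0)" by simp
  also have "\<dots> \<le> integral {\<alpha>..\<beta>} k * norm (deriv g 0)" by (rule mult_right_mono[OF kge]) simp
  also have "\<dots> = norm (of_real (integral {\<alpha>..\<beta>} k) * deriv g 0)"
    using kge0 by (simp add: norm_mult)
  finally have main: "norm (deriv g 0) * 4 / (3 * real m)
    \<le> norm (of_real (integral {\<alpha>..\<beta>} k) * deriv g 0)" .
  show ?thesis unfolding eq
    using norm_diff_ineq[of "of_real (integral {\<alpha>..\<beta>} k) * deriv g 0"
        "integral {\<alpha>..\<beta>} (\<lambda>t. of_real (k t) * E t)"] main err by linarith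
qed

section \<open>Blaschke products and their derivatives at the zeros\<close>

definition blaschke_factor :: "complex \<Rightarrow> complex \<Rightarrow> complex" where
  "blaschke_factor a z = of_real (norm a) / a * ((a - z) / (1 - cnj a * z))"

lemma one_minus_cnj_mult_ge:
  assumes "norm a \<le> 1" "norm z \<le> 1"
  shows "1 - norm z \<le> norm (1 - cnj a * z)" "1 - norm a \<le> norm (1 - cnj a * z)"
proof -
  have "norm (cnj a * z) \<le> norm z" "norm (cnj a * z) \<le> norm a"
    using assms by (auto simp: norm_mult intro: mult_left_le_one_le mult_left_le)
  moreover have "1 - norm (cnj a * z) \<le> norm (1 - cnj a * z)"
    using norm_triangle_ineq2[of 1 "cnj a * z"] by simp
  ultimately show "1 - norm z \<le> norm (1 - cnj a * z)" "1 - norm a \<le> norm (1 - cnj a * z)"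
    by linarith+
qed

lemma one_minus_cnj_mult_nonzero:
  assumes "norm a < 1" "norm z < 1"
  shows "1 - cnj a * z \<noteq> 0"
  using one_minus_cnj_mult_ge(1)[of a z] assms by auto

lemma blaschke_factor_holomorphic:
  assumes "norm a < 1"
  shows "blaschke_factor a holomorphic_on ball 0 1"
proof -
  have "1 - cnj a * z \<noteq> 0" if "z \<in> ball 0 1" for z
    using that assms by (intro one_minus_cnj_mult_nonzero) auto
  then show ?thesis
    unfolding blaschke_factor_def
    by (intro holomorphic_on_mult holomorphic_on_divide holomorphic_on_diff
      holomorphic_on_const holomorphic_on_ident)
qed

lemma norm_blaschke_factor:
  assumes "a \<noteq> 0"
  shows "norm (blaschke_factor a z) = norm (Moebius_function 0 a z)"
  using assms by (simp add: blaschke_factor_def Moebius_function_simple norm_mult norm_divide norm_minus_commute)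

text \<open>This is what makes the product converge locally uniformly when \<open>(\<Sum>k. 1 - norm (a k))\<close> is
  finite: the numerator of the difference has the factor \<open>1 - norm a\<close>.\<close>

lemma norm_blaschke_factor_minus_one_le:
  assumes "a \<noteq> 0" "norm a < 1" "norm z < 1"
  shows "norm (blaschke_factor a z - 1) \<le> 2 * (1 - norm a) / (1 - norm z)"
proof -
  have nz: "1 - cnj a * z \<noteq> 0" using assms one_minus_cnj_mult_nonzero by blast
  have aa: "a * cnj a = of_real (norm a) * of_real (norm a)"
    by (metis complex_norm_square of_real_mult power2_eq_square)
  have "blaschke_factor a z - 1 =
      - ((1 - of_real (norm a)) * (a + of_real (norm a) * z) / (a * (1 - cnj a * z)))"
  proof -
    have "of_real (norm a) * (a - z) - a * (1 - cnj a * z) =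
        of_real (norm a) * (a - z) - a + (a * cnj a) * z" by (simp add: algebra_simps)
    also have "\<dots> = - ((1 - of_real (norm a)) * (a + of_real (norm a) * z))"
      unfolding aa by (simp add: algebra_simps)
    finally have e: "of_real (norm a) * (a - z) - a * (1 - cnj a * z) =
      - ((1 - of_real (norm a)) * (a + of_real (norm a) * z))" .
    have "blaschke_factor a z - 1 = of_real (norm a) * (a - z) / (a * (1 - cnj a * z)) - 1"
      unfolding blaschke_factor_def times_divide_times_eq ..
    also have "\<dots> = (of_real (norm a) * (a - z) - a * (1 - cnj a * z)) / (a * (1 - cnj a * z))"
      using nz assms by (subst divide_diff_eq_iff) auto
    finally have "blaschke_factor a z - 1 =
        (of_real (norm a) * (a - z) - a * (1 - cnj a * z)) / (a * (1 - cnj a * z))" .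
    then show ?thesis by (simp only: e minus_divide_left)
  qed
  then have "norm (blaschke_factor a z - 1) =
      norm (1 - complex_of_real (norm a)) * norm (a + of_real (norm a) * z) / (norm a * norm (1 - cnj a * z))"
    by (simp only: norm_minus_cancel norm_mult norm_divide)
  also have "norm (1 - complex_of_real (norm a)) = 1 - norm a"
    using assms norm_of_real[of "1 - norm a", where ?'a = complex] by simp
  also have "(1 - norm a) * norm (a + of_real (norm a) * z) / (norm a * norm (1 - cnj a * z))
      \<le> (1 - norm a) * (2 * norm a) / (norm a * (1 - norm z))"
  proof (rule frac_le)
    have "norm (a + of_real (norm a) * z) \<le> norm a + norm a * norm z"
      using norm_triangle_ineq[of a "of_real (norm a) * z"] by (simp add: norm_mult)
    also have "\<dots> \<le> 2 * norm a" using assms mult_left_le[of "norm z" "norm a"] by simp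
    finally show "(1 - norm a) * norm (a + of_real (norm a) * z) \<le> (1 - norm a) * (2 * norm a)"
      using assms by (intro mult_left_mono) auto
    show "norm a * (1 - norm z) \<le> norm a * norm (1 - cnj a * z)"
      using one_minus_cnj_mult_ge(1)[of a z] assms by (intro mult_left_mono) auto
  qed (use assms in auto)
  also have "\<dots> = 2 * (1 - norm a) / (1 - norm z)" using assms by simp
  finally show ?thesis .
qed

context
  fixes a :: "nat \<Rightarrow> complex"
  assumes bl: "blaschke_sequence a"
begin

lemma blaschke_sequenceD:
  "a k \<noteq> 0" "norm (a k) < 1" "summable (\<lambda>k. 1 - norm (a k))"
  using bl by (auto simp: blaschke_sequence_def subset_iff image_iff)

lemma blaschke_partial_products_uniform:
  assumes "\<rho> < 1"
  shows "uniform_limit (cball 0 \<rho>) (\<lambda>n z. \<Prod>k<n. blaschke_factor (a k) z)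
    (blaschke_product a) sequentially"
proof -
  have sub: "cball (0::complex) \<rho> \<subseteq> ball 0 1" using assms by auto
  have le: "norm (blaschke_factor (a k) z - 1) \<le> 2 * (1 - norm (a k)) / (1 - \<rho>)"
    if "z \<in> cball 0 \<rho>" for k z
  proof -
    have "norm (blaschke_factor (a k) z - 1) \<le> 2 * (1 - norm (a k)) / (1 - norm z)"
      using that assms by (intro norm_blaschke_factor_minus_one_le blaschke_sequenceD) auto
    also have "\<dots> \<le> 2 * (1 - norm (a k)) / (1 - \<rho>)"
      using that assms blaschke_sequenceD(2)[of k] by (intro divide_left_mono mult_pos_pos) auto
    finally show ?thesis .
  qed
  have sum: "summable (\<lambda>k. 2 * (1 - norm (a k)) / (1 - \<rho>))"
    using blaschke_sequenceD(3) by (intro summable_divide summable_mult)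
  have "uniformly_convergent_on (cball 0 \<rho>) (\<lambda>N z. \<Sum>k<N. norm (blaschke_factor (a k) z - 1))"
    by (rule Weierstrass_m_test'[OF _ sum]) (use le in auto)
  then have "uniformly_convergent_on (cball 0 \<rho>) (\<lambda>N z. \<Prod>k<N. blaschke_factor (a k) z)"
  proof (rule uniformly_convergent_on_prod'[rotated 2])
    show "continuous_on (cball 0 \<rho>) (blaschke_factor (a n))" for n
      using blaschke_factor_holomorphic[OF blaschke_sequenceD(2)] sub
        holomorphic_on_imp_continuous_on holomorphic_on_subset by blast
  qed simp
  then obtain B where B: "uniform_limit (cball 0 \<rho>) (\<lambda>N z. \<Prod>k<N. blaschke_factor (a k) z) B sequentially"
    by (auto simp: uniformly_convergent_on_def)
  have eq: "blaschke_product a z = B z" if z: "z \<in> cball 0 \<rho>" for z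
  proof -
    have "summable (\<lambda>k. norm (blaschke_factor (a k) z - 1))"
      by (rule summable_comparison_test[OF _ sum]) (use le[OF z] in auto)
    then have "convergent_prod (\<lambda>k. blaschke_factor (a k) z)"
      by (intro abs_convergent_prod_imp_convergent_prod summable_imp_abs_convergent_prod)
    then have "(\<lambda>n. \<Prod>k<n. blaschke_factor (a k) z) \<longlonglongrightarrow> blaschke_product a z"
      unfolding blaschke_product_def blaschke_factor_def[symmetric] LIMSEQ_lessThan_iff_atMost by (rule convergent_prod_LIMSEQ)
    moreover have "(\<lambda>n. \<Prod>k<n. blaschke_factor (a k) z) \<longlonglongrightarrow> B z"
      using tendsto_uniform_limitI[OF B z] .
    ultimately show ?thesis by (rule LIMSEQ_unique)
  qed
  show ?thesis by (rule uniform_limit_cong'[THEN iffD2, OF refl eq B])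
qed

lemma blaschke_partial_product_holomorphic:
  "(\<lambda>z. \<Prod>k\<in>J. blaschke_factor (a k) z) holomorphic_on ball 0 1"
  by (intro holomorphic_on_prod blaschke_factor_holomorphic blaschke_sequenceD)

lemma blaschke_product_holomorphic: "blaschke_product a holomorphic_on ball 0 1"
proof (rule holomorphic_uniform_sequence[OF open_ball blaschke_partial_product_holomorphic])
  fix z :: complex assume "z \<in> ball 0 1"
  then have "norm z < 1" by simp
  then obtain \<rho> where \<rho>: "norm z < \<rho>" "\<rho> < 1" using dense by blast
  have sub: "cball z (\<rho> - norm z) \<subseteq> cball 0 \<rho>"
  proof
    fix w assume "w \<in> cball z (\<rho> - norm z)"
    then show "w \<in> cball 0 \<rho>"
      using norm_triangle_ineq2[of w z] by (simp add: dist_norm norm_minus_commute)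
  qed
  show "\<exists>d>0. cball z d \<subseteq> ball 0 1 \<and>
      uniform_limit (cball z d) (\<lambda>n z. \<Prod>k<n. blaschke_factor (a k) z) (blaschke_product a) sequentially"
  proof (intro exI conjI)
    show "cball z (\<rho> - norm z) \<subseteq> ball 0 1"
      using sub cball_subset_ball_iff[of 0 \<rho> 0 1] \<rho> by (auto intro: order_trans)
    show "uniform_limit (cball z (\<rho> - norm z)) (\<lambda>n z. \<Prod>k<n. blaschke_factor (a k) z)
        (blaschke_product a) sequentially"
      by (rule uniform_limit_on_subset[OF blaschke_partial_products_uniform[OF \<rho>(2)] sub])
  qed (use \<rho> in simp)
qed

lemma norm_blaschke_product_le_1:
  assumes "z \<in> ball 0 1"
  shows "norm (blaschke_product a z) \<le> 1"
proof (rule tendsto_upperbound)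
  have "norm z < 1" using assms by simp
  then show "(\<lambda>n. norm (\<Prod>k<n. blaschke_factor (a k) z)) \<longlonglongrightarrow> norm (blaschke_product a z)"
    by (intro tendsto_norm tendsto_uniform_limitI[OF blaschke_partial_products_uniform[of "norm z"]]) auto
  have "norm (\<Prod>k<n. blaschke_factor (a k) z) \<le> 1" for n
    unfolding prod_norm[symmetric] norm_blaschke_factor[OF blaschke_sequenceD(1)]
    using Moebius_function_norm_lt_1[OF blaschke_sequenceD(2) \<open>norm z < 1\<close>]
    by (intro prod_le_1) (auto intro: less_imp_le)
  then show "\<forall>\<^sub>F n in sequentially. norm (\<Prod>k<n. blaschke_factor (a k) z) \<le> 1" by simp
qed simp

text \<open>At its own zero, the \<open>k\<close>-th factor has a derivative of modulus \<open>1 / (1 - (norm (a k))\<^sup>2)\<close>, so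
  the derivative of a partial product there is this times the product of the moduli of the other factors.
  Locally uniform convergence carries the bound over to the full product.\<close>

lemma blaschke_product_deriv_zero_ge:
  assumes P: "\<And>J. finite J \<Longrightarrow> k \<notin> J \<Longrightarrow> P \<le> (\<Prod>j\<in>J. norm (Moebius_function 0 (a j) (a k)))"
  shows "P \<le> (1 - (norm (a k))\<^sup>2) * norm (deriv (blaschke_product a) (a k))"
proof -
  define b where "b = blaschke_factor"
  obtain \<rho> where \<rho>: "norm (a k) < \<rho>" "\<rho> < 1"
    using dense[OF blaschke_sequenceD(2)[of k]] by blast
  have ak: "a k \<in> ball 0 \<rho>" "a k \<in> ball 0 1" using \<rho> by auto
  have "(\<lambda>n. deriv (\<lambda>z. \<Prod>j<n. b (a j) z) (a k)) \<longlonglongrightarrow> deriv (blaschke_product a) (a k)"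
  proof (rule deriv_complex_uniform_limit[OF _ _ _ open_ball ak(1)])
    show "uniform_limit (ball 0 \<rho>) (\<lambda>n z. \<Prod>j<n. b (a j) z) (blaschke_product a) sequentially"
      unfolding b_def using blaschke_partial_products_uniform[OF \<rho>(2)] ball_subset_cball
      by (rule uniform_limit_on_subset)
    have "ball (0::complex) \<rho> \<subseteq> ball 0 1" using \<rho>(2) by auto
    then show "\<forall>\<^sub>F n in sequentially. (\<lambda>z. \<Prod>j<n. b (a j) z) holomorphic_on ball 0 \<rho>"
      unfolding b_def
      by (intro always_eventually allI holomorphic_on_subset[OF blaschke_partial_product_holomorphic])
  qed simp
  then have "(\<lambda>n. (1 - (norm (a k))\<^sup>2) * norm (deriv (\<lambda>z. \<Prod>j<n. b (a j) z) (a k)))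
      \<longlonglongrightarrow> (1 - (norm (a k))\<^sup>2) * norm (deriv (blaschke_product a) (a k))"
    by (intro tendsto_intros)
  moreover have "\<forall>\<^sub>F n in sequentially.
      P \<le> (1 - (norm (a k))\<^sup>2) * norm (deriv (\<lambda>z. \<Prod>j<n. b (a j) z) (a k))"
  proof (rule eventually_sequentiallyI)
    fix n assume n: "Suc k \<le> n"
    have hol: "(\<lambda>z. \<Prod>j\<in>J. b (a j) z) field_differentiable at (a k)" for J
      unfolding b_def
      by (rule holomorphic_on_imp_differentiable_at[OF blaschke_partial_product_holomorphic open_ball ak(2)])
    have split: "(\<Prod>j<n. b (a j) z) = b (a k) z * (\<Prod>j\<in>{..<n} - {k}. b (a j) z)" for z
      using n by (intro prod.remove) auto
    have bk0: "b (a k) (a k) = 0" by (simp add: b_def blaschke_factor_def)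
    have nz: "1 - cnj (a k) * a k \<noteq> 0"
      using one_minus_cnj_mult_nonzero blaschke_sequenceD(2) by blast
    have sq: "1 - cnj (a k) * a k = of_real (1 - (norm (a k))\<^sup>2)"
      by (simp only: of_real_diff of_real_1 complex_norm_square mult.commute)
    have dbk: "(b (a k) has_field_derivative
        of_real (norm (a k)) / a k * (- 1 / (1 - cnj (a k) * a k))) (at (a k))"
    proof -
      have "((\<lambda>z. (a k - z) / (1 - cnj (a k) * z)) has_field_derivative
          ((0 - 1) * (1 - cnj (a k) * a k) - (a k - a k) * (0 - cnj (a k) * 1)) /
          ((1 - cnj (a k) * a k) * (1 - cnj (a k) * a k))) (at (a k))"
        by (intro DERIV_divide DERIV_diff DERIV_const DERIV_ident DERIV_cmult nz)
      then have "((\<lambda>z. (a k - z) / (1 - cnj (a k) * z)) has_field_derivative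
          - 1 / (1 - cnj (a k) * a k)) (at (a k))"
      proof (rule DERIV_cong)
        have "((0 - 1) * u - (a k - a k) * v) / (u * u) = - 1 / u" if "u \<noteq> 0" for u v :: complex
          using that by simp
        then show "((0 - 1) * (1 - cnj (a k) * a k) - (a k - a k) * (0 - cnj (a k) * 1)) /
          ((1 - cnj (a k) * a k) * (1 - cnj (a k) * a k)) = - 1 / (1 - cnj (a k) * a k)"
          using nz .
      qed
      then show ?thesis unfolding b_def blaschke_factor_def by (rule DERIV_cmult)
    qed
    have d: "deriv (\<lambda>z. \<Prod>j<n. b (a j) z) (a k) =
      of_real (norm (a k)) / a k * (- 1 / of_real (1 - (norm (a k))\<^sup>2)) *
      (\<Prod>j\<in>{..<n} - {k}. b (a j) (a k))"
    proof (rule DERIV_imp_deriv)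
      let ?Q = "\<lambda>z. \<Prod>j\<in>{..<n} - {k}. b (a j) z"
      obtain Q' where "(?Q has_field_derivative Q') (at (a k))"
        using hol field_differentiable_def by blast
      from DERIV_mult[OF dbk this]
      show "((\<lambda>z. \<Prod>j<n. b (a j) z) has_field_derivative
        of_real (norm (a k)) / a k * (- 1 / of_real (1 - (norm (a k))\<^sup>2)) * ?Q (a k)) (at (a k))"
        unfolding split bk0 sq by simp
    qed
    have pos: "0 < 1 - (norm (a k))\<^sup>2"
      using blaschke_sequenceD(2)[of k] by (simp add: abs_square_less_1)
    have "norm (deriv (\<lambda>z. \<Prod>j<n. b (a j) z) (a k)) =
        1 / (1 - (norm (a k))\<^sup>2) * norm (\<Prod>j\<in>{..<n} - {k}. b (a j) (a k))"
      unfolding d norm_mult norm_divide norm_of_real using pos blaschke_sequenceD(1)[of k] by simp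
    moreover have "norm (\<Prod>j\<in>{..<n} - {k}. b (a j) (a k)) =
        (\<Prod>j\<in>{..<n} - {k}. norm (Moebius_function 0 (a j) (a k)))"
      unfolding prod_norm[symmetric] b_def norm_blaschke_factor[OF blaschke_sequenceD(1)] ..
    ultimately show "P \<le> (1 - (norm (a k))\<^sup>2) * norm (deriv (\<lambda>z. \<Prod>j<n. b (a j) z) (a k))"
      using P[of "{..<n} - {k}"] pos by simp
  qed
  ultimately show ?thesis by (rule tendsto_lowerbound) simp
qed

end

section \<open>Moving the kernel to a point of the radius\<close>

text \<open>The image of the segment under the Moebius map need not be a segment. Both integrals are
  therefore evaluated with one primitive \<open>H\<close> of the transformed integrand: \<open>H \<circ> \<psi>\<close> is a
  primitive of the original one.\<close>

lemma Moebius_change_of_variables: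
  assumes w: "norm w < 1" and z: "z1 \<in> ball 0 1" "z2 \<in> ball 0 1"
    and B: "B holomorphic_on ball 0 1" and G: "G holomorphic_on ball 0 1"
  shows "contour_integral (linepath z1 z2) (\<lambda>z. G (Moebius_function 0 w z) * deriv B z) =
    contour_integral (linepath (Moebius_function 0 w z1) (Moebius_function 0 w z2))
      (\<lambda>\<zeta>. G \<zeta> * deriv (B \<circ> Moebius_function 0 (- w)) \<zeta>)"
proof -
  define \<psi> where "\<psi> = Moebius_function 0 w"
  define g where "g = B \<circ> Moebius_function 0 (- w)"
  have maps: "\<psi> ` ball 0 1 \<subseteq> ball 0 1" "Moebius_function 0 (- w) ` ball 0 1 \<subseteq> ball 0 1"
    using Moebius_function_norm_lt_1 w by (auto simp: \<psi>_def)
  have hol\<psi>: "\<psi> holomorphic_on ball 0 1" "Moebius_function 0 (- w) holomorphic_on ball 0 1"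
    using Moebius_function_holomorphic w by (auto simp: \<psi>_def)
  have holg: "g holomorphic_on ball 0 1"
    unfolding g_def using hol\<psi>(2) B maps(2) by (rule holomorphic_on_compose_gen)
  obtain H where H: "\<And>x. x \<in> ball 0 1 \<Longrightarrow>
      (H has_field_derivative G x * deriv g x) (at x within ball 0 1)"
  proof (rule holomorphic_convex_primitive')
    show "(\<lambda>x. G x * deriv g x) holomorphic_on ball 0 1"
      using G holg by (intro holomorphic_intros holomorphic_deriv) auto
  qed auto
  have Bg: "B z = g (\<psi> z)" if "z \<in> ball 0 1" for z
    using that w by (simp add: g_def \<psi>_def Moebius_function_compose)
  have H\<psi>: "((\<lambda>z. H (\<psi> z)) has_field_derivative G (\<psi> z) * deriv B z) (at z within ball 0 1)"
    if zb: "z \<in> ball 0 1" for z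
  proof -
    have pz: "\<psi> z \<in> ball 0 1" using maps(1) zb by blast
    have d\<psi>: "(\<psi> has_field_derivative deriv \<psi> z) (at z)"
      using holomorphic_derivI[OF hol\<psi>(1) open_ball zb] .
    have dg: "(g has_field_derivative deriv g (\<psi> z)) (at (\<psi> z))"
      using holomorphic_derivI[OF holg open_ball pz] .
    have "((\<lambda>z. g (\<psi> z)) has_field_derivative deriv g (\<psi> z) * deriv \<psi> z) (at z)"
      using DERIV_chain2[OF dg d\<psi>] .
    then have "(B has_field_derivative deriv g (\<psi> z) * deriv \<psi> z) (at z)"
      by (rule has_field_derivative_transform_within_open[OF _ open_ball zb]) (simp add: Bg)
    then have dB: "deriv B z = deriv g (\<psi> z) * deriv \<psi> z" by (rule DERIV_imp_deriv)
    have "(H has_field_derivative G (\<psi> z) * deriv g (\<psi> z)) (at (\<psi> z))"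
      using H[OF pz] at_within_open[OF pz open_ball] by simp
    from DERIV_chain2[OF this d\<psi>]
    have "((\<lambda>z. H (\<psi> z)) has_field_derivative G (\<psi> z) * deriv B z) (at z)"
      unfolding dB by (simp add: mult.assoc)
    then show ?thesis by (rule has_field_derivative_at_within)
  qed
  have seg: "path_image (linepath u v) \<subseteq> ball 0 1" if "u \<in> ball 0 1" "v \<in> ball 0 1" for u v :: complex
    using that by (simp add: closed_segment_subset)
  have pz: "\<psi> z1 \<in> ball 0 1" "\<psi> z2 \<in> ball 0 1" using maps z by blast+
  have "contour_integral (linepath z1 z2) (\<lambda>z. G (\<psi> z) * deriv B z) = H (\<psi> z2) - H (\<psi> z1)"
    using contour_integral_primitive[OF H\<psi> valid_path_linepath seg[OF z]]
    by (simp add: contour_integral_unique)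
  moreover have "contour_integral (linepath (\<psi> z1) (\<psi> z2)) (\<lambda>z. G z * deriv g z) = H (\<psi> z2) - H (\<psi> z1)"
    using contour_integral_primitive[OF H valid_path_linepath seg[OF pz]]
    by (simp add: contour_integral_unique)
  ultimately show ?thesis unfolding \<psi>_def g_def by simp
qed

text \<open>The lower bounds on \<open>\<alpha>\<close> and \<open>\<rho>\<close> ensure that the Moebius map sends \<open>[0, \<rho>]\<close> to an interval that
  contains \<open>[-1/2, 1/2]\<close>, where the bulk of the kernel lies.\<close>

lemma peak_integral_ge:
  fixes \<alpha> \<rho> :: real
  assumes \<alpha>: "1/2 \<le> \<alpha>" "\<alpha> < 1" and \<rho>: "(1 + 2 * \<alpha>) / (2 + \<alpha>) \<le> \<rho>" "\<rho> < 1"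
    and B: "B holomorphic_on ball 0 1" "\<And>z. z \<in> ball 0 1 \<Longrightarrow> norm (B z) \<le> 1"
    and m: "2 \<le> (m::nat)"
  shows "(1 - \<alpha>\<^sup>2) * norm (deriv B (of_real \<alpha>)) * 4 / (3 * real m) - 8 / (real m ^ 2 - 1)
    \<le> norm (contour_integral (linepath 0 (of_real \<rho>))
        (\<lambda>z. (1 - (Moebius_function 0 (of_real \<alpha>) z)\<^sup>2) ^ m\<^sup>2 * deriv B z))"
proof -
  define g where "g = B \<circ> Moebius_function 0 (- of_real \<alpha>)"
  have a1: "norm (of_real \<alpha> :: complex) < 1" "norm (- of_real \<alpha> :: complex) < 1" using \<alpha> by auto
  have maps: "Moebius_function 0 (- of_real \<alpha>) ` ball 0 1 \<subseteq> ball 0 1"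
    using Moebius_function_norm_lt_1 a1(2) by auto
  have hol: "Moebius_function 0 (- of_real \<alpha>) holomorphic_on ball 0 1"
    using Moebius_function_holomorphic a1(2) by auto
  have holg: "g holomorphic_on ball 0 1"
    unfolding g_def using hol B(1) maps by (rule holomorphic_on_compose_gen)
  have bdg: "norm (g z) \<le> 1" if "z \<in> ball 0 1" for z
    using that B(2) maps by (simp add: g_def image_subset_iff)
  define \<beta> where "\<beta> = (\<rho> - \<alpha>) / (1 - \<alpha> * \<rho>)"
  have "0 < (1 + 2 * \<alpha>) / (2 + \<alpha>)" using \<alpha> by simp
  then have \<rho>0: "0 < \<rho>" using \<rho>(1) by linarith
  have den: "0 < 1 - \<alpha> * \<rho>" using \<alpha> \<rho> \<rho>0 mult_strict_mono[of \<alpha> 1 \<rho> 1] by simp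
  have "1 + 2 * \<alpha> \<le> \<rho> * (2 + \<alpha>)" using \<rho>(1) \<alpha> by (simp add: divide_le_eq)
  then have "1/2 * (1 - \<alpha> * \<rho>) \<le> \<rho> - \<alpha>" unfolding ring_distribs mult.commute[of \<rho>] by linarith
  then have \<beta>1: "1/2 \<le> \<beta>" using den by (simp only: \<beta>_def le_divide_eq if_True)
  have "0 < (1 - \<rho>) * (1 + \<alpha>)" using \<rho> \<alpha> by simp
  then have \<beta>2: "\<beta> < 1" using den by (simp add: \<beta>_def divide_less_eq algebra_simps)
  have M0: "Moebius_function 0 (of_real \<alpha>) 0 = of_real (- \<alpha>)"
    by (simp add: Moebius_function_simple)
  have M1: "Moebius_function 0 (of_real \<alpha>) (of_real \<rho>) = of_real \<beta>"
    by (simp add: Moebius_function_simple \<beta>_def)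
  have "contour_integral (linepath 0 (of_real \<rho>))
        (\<lambda>z. (1 - (Moebius_function 0 (of_real \<alpha>) z)\<^sup>2) ^ m\<^sup>2 * deriv B z)
      = contour_integral (linepath (of_real (- \<alpha>)) (of_real \<beta>)) (\<lambda>\<zeta>. (1 - \<zeta>\<^sup>2) ^ m\<^sup>2 * deriv g \<zeta>)"
    unfolding M0[symmetric] M1[symmetric] g_def
    using a1 \<rho> \<rho>0 B(1)
    by (intro Moebius_change_of_variables[where G = "\<lambda>\<zeta>. (1 - \<zeta>\<^sup>2) ^ m\<^sup>2"]) (auto intro!: holomorphic_intros)
  moreover have "norm (deriv g 0) * 4 / (3 * real m) - 8 / (real m ^ 2 - 1)
    \<le> norm (contour_integral (linepath (of_real (- \<alpha>)) (of_real \<beta>)) (\<lambda>z. (1 - z\<^sup>2) ^ m\<^sup>2 * deriv g z))"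
    by (rule kernel_integral_deriv_ge[OF holg bdg _ _ \<beta>1 \<beta>2 m]) (use \<alpha> in auto)
  moreover have "norm (deriv g 0) = (1 - \<alpha>\<^sup>2) * norm (deriv B (of_real \<alpha>))"
  proof -
    have dM: "(Moebius_function 0 (- of_real \<alpha>) has_field_derivative of_real (1 - \<alpha>\<^sup>2)) (at 0)"
      unfolding Moebius_function_simple
      by (rule derivative_eq_intros refl | simp)+ (simp add: power2_eq_square)
    have M: "Moebius_function 0 (- of_real \<alpha>) 0 = of_real \<alpha>"
      by (simp add: Moebius_function_simple)
    have "(B has_field_derivative deriv B (of_real \<alpha>)) (at (Moebius_function 0 (- of_real \<alpha>) 0))"
      unfolding M using a1 by (intro holomorphic_derivI[OF B(1) open_ball]) auto
    from DERIV_chain[OF this dM]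
    have "deriv g 0 = deriv B (of_real \<alpha>) * of_real (1 - \<alpha>\<^sup>2)"
      unfolding g_def by (rule DERIV_imp_deriv)
    moreover have "0 \<le> 1 - \<alpha>\<^sup>2" using \<alpha> by (simp add: abs_square_le_1)
    ultimately show ?thesis by (simp add: norm_mult mult.commute del: of_real_diff)
  qed
  ultimately show ?thesis by simp
qed

text \<open>The identity \<open>1 - \<psi>\<^sup>2 = (1 - \<alpha>\<^sup>2) (1 - z\<^sup>2) / (1 - \<alpha> z)\<^sup>2\<close> shows the decay, since
  \<open>norm (1 - \<alpha> z)\<close> dominates both \<open>1 - \<alpha>\<close> and half of \<open>norm (1 - z)\<close>.\<close>

lemma norm_peak_le:
  fixes \<alpha> :: real
  assumes \<alpha>: "0 < \<alpha>" "\<alpha> < 1" and z: "norm z < 1"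
  shows "norm (1 - (Moebius_function 0 (of_real \<alpha>) z)\<^sup>2) \<le> 2"
    and "norm (1 - (Moebius_function 0 (of_real \<alpha>) z)\<^sup>2)
      \<le> 16 * min ((1 - \<alpha>) / norm (1 - z)) (norm (1 - z) / (1 - \<alpha>))"
proof -
  have a1: "norm (of_real \<alpha> :: complex) < 1" using \<alpha> by simp
  have "norm (Moebius_function 0 (of_real \<alpha>) z) < 1"
    by (rule Moebius_function_norm_lt_1[OF a1 z])
  then have "norm ((Moebius_function 0 (of_real \<alpha>) z)\<^sup>2) \<le> 1"
    by (simp add: norm_power power_le_one)
  then show "norm (1 - (Moebius_function 0 (of_real \<alpha>) z)\<^sup>2) \<le> 2"
    using norm_triangle_ineq4[of 1 "(Moebius_function 0 (of_real \<alpha>) z)\<^sup>2"] by simp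
  define D where "D = norm (1 - of_real \<alpha> * z)"
  define d where "d = norm (1 - z)"
  define x where "x = 1 - \<alpha>"
  have x: "0 < x" using \<alpha> by (simp add: x_def)
  have d: "0 < d" using z by (auto simp: d_def)
  have nz: "1 - of_real \<alpha> * z \<noteq> 0"
    using one_minus_cnj_mult_nonzero[OF a1 z] by simp
  have Dx: "x \<le> D" using one_minus_cnj_mult_ge(2)[of "of_real \<alpha>" z] \<alpha> z by (simp add: D_def x_def)
  have dD: "d \<le> 2 * D"
  proof -
    have "1 - z = (1 - of_real \<alpha> * z) - of_real x * z" by (simp add: x_def algebra_simps)
    then have "d \<le> D + norm (of_real x * z)"
      unfolding d_def D_def by (metis norm_triangle_ineq4)
    moreover have "norm (of_real x * z) \<le> x"
      using x z by (simp add: norm_mult mult_left_le)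
    ultimately show ?thesis using Dx by linarith
  qed
  have "1 - (Moebius_function 0 (of_real \<alpha>) z)\<^sup>2
      = of_real (1 + \<alpha>) * of_real x * (1 + z) * (1 - z) / (1 - of_real \<alpha> * z)\<^sup>2"
    using nz by (simp add: Moebius_function_simple x_def power_divide divide_simps)
      (simp add: algebra_simps power2_eq_square)
  then have eq: "norm (1 - (Moebius_function 0 (of_real \<alpha>) z)\<^sup>2) = (1 + \<alpha>) * x * norm (1 + z) * d / D\<^sup>2"
    using \<alpha> x by (simp only: norm_mult norm_divide norm_power norm_of_real d_def D_def abs_of_pos add_pos_pos zero_less_one)
  have "(1 + \<alpha>) * x * norm (1 + z) * d \<le> 2 * x * 2 * d"
    using \<alpha> x d z norm_triangle_ineq[of 1 z] by (intro mult_mono mult_nonneg_nonneg) auto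
  then have "norm (1 - (Moebius_function 0 (of_real \<alpha>) z)\<^sup>2) \<le> 4 * x * d / D\<^sup>2"
    unfolding eq by (intro divide_right_mono) auto
  moreover have "4 * x * d / D\<^sup>2 \<le> 16 * (x / d)"
  proof -
    have "d\<^sup>2 \<le> (2 * D)\<^sup>2" using dD d by (intro power_mono) auto
    then have "4 * x * d / D\<^sup>2 \<le> 4 * x * d / (d\<^sup>2 / 4)"
      using x d by (intro divide_left_mono) (auto simp: power_mult_distrib intro!: mult_pos_pos)
    also have "\<dots> = 16 * (x / d)" using d by (simp add: power2_eq_square)
    finally show ?thesis .
  qed
  moreover have "4 * x * d / D\<^sup>2 \<le> 16 * (d / x)"
  proof -
    have "x\<^sup>2 \<le> D\<^sup>2" using Dx x by (intro power_mono) auto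
    then have "4 * x * d / D\<^sup>2 \<le> 4 * x * d / x\<^sup>2"
      using x d Dx by (intro divide_left_mono) (auto intro!: mult_pos_pos)
    also have "\<dots> = 4 * (d / x)" using x by (simp add: power2_eq_square)
    also have "\<dots> \<le> 16 * (d / x)" using x d by (intro mult_right_mono) auto
    finally show ?thesis .
  qed
  ultimately show "norm (1 - (Moebius_function 0 (of_real \<alpha>) z)\<^sup>2)
      \<le> 16 * min ((1 - \<alpha>) / norm (1 - z)) (norm (1 - z) / (1 - \<alpha>))"
    unfolding x_def[symmetric] d_def[symmetric] by (simp add: min_def)
qed

section \<open>Interpolation on the radius and unboundedness\<close>

lemma interpolating_sequenceE:
  assumes "interpolating_sequence a" "\<And>k. norm (w k) \<le> 1"
  obtains f where "f \<in> Hinf" "\<And>k. f (a k) = w k"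
proof -
  have "bounded (range w)" using assms(2) by (intro boundedI[where B = 1]) auto
  then show thesis using assms(1) that unfolding interpolating_sequence_def by blast
qed

lemma interpolating_sequence_inj:
  assumes "interpolating_sequence a"
  shows "inj a"
proof (rule injI, rule ccontr)
  fix i j assume ij: "a i = a j" "i \<noteq> j"
  define w :: "nat \<Rightarrow> complex" where "w k = (if k = i then 1 else 0)" for k
  have "norm (w k) \<le> 1" for k by (simp add: w_def)
  then obtain f where f: "\<And>k. f (a k) = w k"
    using interpolating_sequenceE[OF assms, of w] by metis
  then show False using ij by (metis w_def zero_neq_one)
qed

text \<open>Interpolating the values \<open>(-1) ^ rank\<close> separates neighbouring points: the function jumps by 2
  from \<open>\<alpha> i\<close> to the next point \<open>\<alpha> j\<close>, with derivative at most \<open>K / (1 - \<alpha> j)\<close> in between. Hence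
  \<open>2 (1 - \<alpha> j) \<le> K (\<alpha> j - \<alpha> i)\<close>, which is the decay with ratio \<open>K / (K + 2)\<close>. Separation of
  neighbours suffices because the points lie on a line, so that the steps accumulate.\<close>

lemma interpolating_real_geometric_decay:
  fixes \<alpha> :: "nat \<Rightarrow> real"
  assumes \<alpha>: "\<And>k. 0 < \<alpha> k" "\<And>k. \<alpha> k < 1"
    and sum: "summable (\<lambda>k. 1 - \<alpha> k)"
    and interp: "interpolating_sequence (\<lambda>k. of_real (\<alpha> k))"
  obtains q where "geometric_decay q (\<lambda>k. 1 - \<alpha> k) (\<lambda>k. card {j. \<alpha> j < \<alpha> k})"
proof -
  define r where "r k = card {j. \<alpha> j < \<alpha> k}" for k
  have inj: "\<alpha> i = \<alpha> j \<Longrightarrow> i = j" for i j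
    using interpolating_sequence_inj[OF interp] by (simp add: inj_def)
  have fin: "finite {j. \<alpha> j < \<alpha> k}" for k
  proof -
    have "(\<lambda>j. 1 - \<alpha> j) \<longlonglongrightarrow> 0" using sum by (rule summable_LIMSEQ_zero)
    then have "\<forall>\<^sub>F j in sequentially. 1 - \<alpha> j < 1 - \<alpha> k"
      using \<alpha>(2)[of k] by (intro order_tendstoD(2)) auto
    then obtain N where N: "\<And>j. j \<ge> N \<Longrightarrow> 1 - \<alpha> j < 1 - \<alpha> k"
      by (auto simp: eventually_sequentially)
    have "{j. \<alpha> j < \<alpha> k} \<subseteq> {..<N}" using N by (force simp: not_le[symmetric])
    then show ?thesis using finite_subset by blast
  qed
  have r_mono: "r i < r j" if "\<alpha> i < \<alpha> j" for i j
    unfolding r_def by (rule psubset_card_mono[OF fin]) (use that in auto)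
  have r_inj: "inj r"
  proof (rule injI)
    fix i j assume "r i = r j"
    then have "\<alpha> i = \<alpha> j" using r_mono[of i j] r_mono[of j i] by linarith
    then show "i = j" by (rule inj)
  qed
  obtain f where f: "f \<in> Hinf" "\<And>k. f (of_real (\<alpha> k)) = (-1) ^ r k"
    by (rule interpolating_sequenceE[OF interp, of "\<lambda>k. (-1) ^ r k"]) (auto simp: norm_power)
  then have hol: "f holomorphic_on ball 0 1" and "bounded (f ` ball 0 1)"
    by (auto simp: Hinf_def)
  then obtain K where K: "0 < K" "\<And>z. z \<in> ball 0 1 \<Longrightarrow> norm (f z) \<le> K"
    unfolding bounded_pos by auto
  define q where "q = K / (K + 2)"
  have q: "0 < q" "q < 1" using K(1) by (auto simp: q_def)
  \<comment> \<open>Ranks have no gaps: the largest point below \<open>\<alpha> j\<close> has the preceding rank.\<close>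
  have pred: "\<exists>i. r i = n \<and> \<alpha> i < \<alpha> j" if "r j = Suc n" for j n
  proof -
    let ?A = "{i. \<alpha> i < \<alpha> j}"
    have ne: "?A \<noteq> {}" by (metis r_def card.empty nat.distinct(1) that)
    have "Max (\<alpha> ` ?A) \<in> \<alpha> ` ?A" using fin ne by (intro Max_in) auto
    then obtain i where i: "i \<in> ?A" "\<alpha> i = Max (\<alpha> ` ?A)" by auto
    have le: "\<alpha> k \<le> \<alpha> i" if "k \<in> ?A" for k
      unfolding i(2) using fin that by (intro Max_ge) auto
    have "{k. \<alpha> k < \<alpha> i} = ?A - {i}"
    proof (intro equalityI subsetI)
      fix k assume "k \<in> ?A - {i}"
      then have "\<alpha> k \<le> \<alpha> i" "\<alpha> k \<noteq> \<alpha> i" using le inj by auto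
      then show "k \<in> {k. \<alpha> k < \<alpha> i}" by simp
    qed (use i(1) in auto)
    then have "r i = n" using i(1) fin that by (simp add: r_def)
    then show ?thesis using i(1) by auto
  qed
  have adjacent: "1 - \<alpha> j \<le> q * (1 - \<alpha> i)" if "r j = Suc (r i)" "\<alpha> i < \<alpha> j" for i j
  proof -
    have "norm (f (of_real (\<alpha> j)) - f (of_real (\<alpha> i)))
        \<le> K / (1 - \<alpha> j) * norm (complex_of_real (\<alpha> j) - of_real (\<alpha> i))"
    proof (rule field_differentiable_bound[where S = "cball 0 (\<alpha> j)" and f' = "deriv f"])
      fix z :: complex assume z: "z \<in> cball 0 (\<alpha> j)"
      then have z1: "norm z < 1" using \<alpha>(2)[of j] by auto
      then show "(f has_field_derivative deriv f z) (at z within cball 0 (\<alpha> j))"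
        using holomorphic_derivI[OF hol open_ball, of z] has_field_derivative_at_within by auto
      have "norm ((deriv ^^ 1) f z) \<le> fact 1 * K / (1 - norm z) ^ 1"
        by (rule Cauchy_bound_unit_disk[OF hol K(2) z1])
      also have "\<dots> \<le> K / (1 - \<alpha> j)"
        using z z1 K(1) \<alpha>(2)[of j] by (auto intro!: divide_left_mono mult_pos_pos)
      finally show "norm (deriv f z) \<le> K / (1 - \<alpha> j)" by simp
    qed (use \<alpha>(1)[of i] \<alpha>(1)[of j] that in auto)
    also have "norm (complex_of_real (\<alpha> j) - of_real (\<alpha> i)) = \<alpha> j - \<alpha> i"
      using that(2) norm_of_real[of "\<alpha> j - \<alpha> i", where ?'a = complex] by simp
    also have "norm (f (of_real (\<alpha> j)) - f (of_real (\<alpha> i))) = 2"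
    proof -
      have "f (of_real (\<alpha> j)) - f (of_real (\<alpha> i)) = (-1) ^ r i * (- 2)"
        by (simp add: f(2) that(1))
      then show ?thesis by (simp add: norm_mult norm_power)
    qed
    finally have "2 * (1 - \<alpha> j) \<le> K * (\<alpha> j - \<alpha> i)"
      using \<alpha>(2)[of j] by (simp add: field_simps)
    then show ?thesis using K(1) by (simp add: q_def field_simps)
  qed
  have decay: "1 - \<alpha> j \<le> q ^ n * (1 - \<alpha> k)" if "r j = r k + n" for j k n
    using that
  proof (induction n arbitrary: j)
    case 0
    then have "j = k" using r_inj by (simp add: inj_eq)
    then show ?case by simp
  next
    case (Suc n)
    then obtain i where i: "r i = r k + n" "\<alpha> i < \<alpha> j" using pred[of j "r k + n"] by auto
    have "1 - \<alpha> j \<le> q * (1 - \<alpha> i)" using i Suc.prems by (intro adjacent) auto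
    also have "\<dots> \<le> q * (q ^ n * (1 - \<alpha> k))" using Suc.IH[OF i(1)] q by (intro mult_left_mono) auto
    finally show ?case by simp
  qed
  have "geometric_decay q (\<lambda>k. 1 - \<alpha> k) r"
    by unfold_locales (use q \<alpha> r_inj decay in auto)
  then show thesis using that unfolding r_def by blast
qed

lemma pseudohyperbolic_ge:
  fixes s t :: real
  assumes "0 < s" "s < 1" "0 < t" "t < 1"
  shows "\<bar>(1 - s) - (1 - t)\<bar> / ((1 - s) + (1 - t)) \<le> norm (Moebius_function 0 (of_real s) (of_real t))"
proof -
  have st: "0 < 1 - s * t" using assms mult_strict_mono[of s 1 t 1] by simp
  have "0 \<le> (1 - s) * (1 - t)" using assms by simp
  then have le: "1 - s * t \<le> (1 - s) + (1 - t)" by (simp add: algebra_simps)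
  have "Moebius_function 0 (of_real s) (of_real t) = of_real ((t - s) / (1 - s * t))"
    by (simp add: Moebius_function_simple)
  then have "norm (Moebius_function 0 (of_real s) (of_real t)) = \<bar>t - s\<bar> / (1 - s * t)"
    using st by (simp only: norm_of_real) simp
  moreover have "\<bar>(1 - s) - (1 - t)\<bar> / ((1 - s) + (1 - t)) \<le> \<bar>t - s\<bar> / (1 - s * t)"
    using le st by (intro frac_le) auto
  ultimately show ?thesis by simp
qed

lemma norm_le_Hinf_norm:
  assumes "f \<in> Hinf" "z \<in> ball 0 1"
  shows "norm (f z) \<le> Hinf_norm f"
proof -
  have "bdd_above ((\<lambda>z. norm (f z)) ` ball 0 1)"
    using assms(1) by (auto simp: Hinf_def bounded_iff bdd_above_def)
  then show ?thesis unfolding Hinf_norm_def using assms(2) by (rule cSUP_upper2) simp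
qed

lemma HinfI:
  assumes "f holomorphic_on ball 0 1" "\<And>z. z \<in> ball 0 1 \<Longrightarrow> norm (f z) \<le> M"
  shows "f \<in> Hinf" "Hinf_norm f \<le> M"
proof -
  show "f \<in> Hinf" using assms by (auto simp: Hinf_def intro!: boundedI)
  show "Hinf_norm f \<le> M" unfolding Hinf_norm_def using assms(2) by (intro cSUP_least) auto
qed

theorem theorem2p10:
  fixes a :: "nat \<Rightarrow> complex"
  assumes "range a \<subseteq> complex_of_real ` {0<..<1}"
    and "blaschke_sequence a"
    and "interpolating_sequence a"
  shows "\<not> bounded_on_Hinf (volterra (blaschke_product a))"
proof
  assume bounded: "bounded_on_Hinf (volterra (blaschke_product a))"
  define B where "B = blaschke_product a"
  define \<alpha> where "\<alpha> k = Re (a k)" for k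
  have "\<forall>k. \<exists>t. a k = complex_of_real t \<and> 0 < t \<and> t < 1" using assms(1) by fastforce
  then have a: "a k = of_real (\<alpha> k)" and \<alpha>: "0 < \<alpha> k" "\<alpha> k < 1" for k
    by (metis \<alpha>_def Re_complex_of_real)+
  have a_eq: "a = (\<lambda>k. of_real (\<alpha> k))" using a by auto
  have sum: "summable (\<lambda>k. 1 - \<alpha> k)"
    using blaschke_sequenceD(3)[OF assms(2)] \<alpha>(1) by (simp add: a abs_of_pos)
  define r where "r k = card {j. \<alpha> j < \<alpha> k}" for k
  obtain q where "geometric_decay q (\<lambda>k. 1 - \<alpha> k) r"
    using interpolating_real_geometric_decay[OF \<alpha> sum] assms(3)
    unfolding a_eq r_def by blast
  then interpret geometric_decay q "\<lambda>k. 1 - \<alpha> k" r .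
  obtain P where P: "0 < P" and PJ: "\<And>k J. finite J \<Longrightarrow> k \<notin> J \<Longrightarrow>
      P \<le> (\<Prod>j\<in>J. \<bar>(1 - \<alpha> j) - (1 - \<alpha> k)\<bar> / ((1 - \<alpha> j) + (1 - \<alpha> k)))"
    by (rule prod_quotient_lower_bound) blast
  have holB: "B holomorphic_on ball 0 1"
    unfolding B_def using assms(2) by (rule blaschke_product_holomorphic)
  have bdB: "norm (B z) \<le> 1" if "z \<in> ball 0 1" for z
    unfolding B_def using assms(2) that by (rule norm_blaschke_product_le_1)
  have derB: "P \<le> (1 - (\<alpha> k)\<^sup>2) * norm (deriv B (of_real (\<alpha> k)))" for k
  proof -
    have "P \<le> (\<Prod>j\<in>J. norm (Moebius_function 0 (a j) (a k)))" if "finite J" "k \<notin> J" for J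
    proof -
      have "P \<le> (\<Prod>j\<in>J. \<bar>(1 - \<alpha> j) - (1 - \<alpha> k)\<bar> / ((1 - \<alpha> j) + (1 - \<alpha> k)))"
        using that by (rule PJ)
      also have "\<dots> \<le> (\<Prod>j\<in>J. norm (Moebius_function 0 (a j) (a k)))"
        unfolding a using \<alpha> less_imp_le[OF \<alpha>(2)]
        by (intro prod_mono conjI pseudohyperbolic_ge divide_nonneg_nonneg add_nonneg_nonneg) auto
      finally show ?thesis .
    qed
    from blaschke_product_deriv_zero_ge[OF assms(2) this]
    show ?thesis using \<alpha>(1)[of k] unfolding B_def a[of k] by simp
  qed
  \<comment> \<open>For \<open>m \<ge> 2\<close>, \<open>m > 8 / P\<close> is what makes the main term of the kernel integral exceed its error.\<close>
  obtain m :: nat where m: "max 2 (8 / P) < real m" using reals_Archimedean2 by blast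
  then have m2: "2 \<le> m" by simp
  define c where "c = P * 4 / (3 * real m) - 8 / (real m ^ 2 - 1)"
  have c: "0 < c"
  proof -
    have "2 * 2 \<le> real m * real m" using m2 by (intro mult_mono) auto
    then have m4: "3 / 4 * real m ^ 2 \<le> real m ^ 2 - 1" "0 < real m ^ 2" by (auto simp: power2_eq_square)
    then have "8 / (real m ^ 2 - 1) \<le> 8 / (3 / 4 * real m ^ 2)" by (intro divide_left_mono) auto
    also have "\<dots> = 32 / (3 * real m) / real m" using m2 by (simp add: power2_eq_square)
    also have "\<dots> < 4 * P / (3 * real m)"
      using m m2 P by (simp add: field_simps)
    finally show ?thesis by (simp add: c_def mult.commute)
  qed
  define F where "F k z = (1 - (Moebius_function 0 (of_real (\<alpha> k)) z)\<^sup>2) ^ m\<^sup>2" for k z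
  define M where "M = 2 ^ (m\<^sup>2 - 1) * 16 * (2 / (1 - q))"
  have holF: "F k holomorphic_on ball 0 1" for k
    unfolding F_def using \<alpha>[of k] by (intro holomorphic_intros Moebius_function_holomorphic) auto
  have sumF: "(\<Sum>k\<in>S. norm (F k z)) \<le> M" if S: "finite S" and z: "z \<in> ball 0 1" for S z
  proof -
    have z1: "norm z < 1" using z by simp
    then have d: "0 < norm (1 - z)" by auto
    \<comment> \<open>One factor of the power gives the decay, the others are bounded by 2.\<close>
    have Fle: "norm (F k z) \<le> 2 ^ (m\<^sup>2 - 1) * 16 * min ((1 - \<alpha> k) / norm (1 - z)) (norm (1 - z) / (1 - \<alpha> k))" for k
    proof -
      define u where "u = norm (1 - (Moebius_function 0 (of_real (\<alpha> k)) z)\<^sup>2)"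
      have "m\<^sup>2 = Suc (m\<^sup>2 - 1)" using m2 by simp
      then have "norm (F k z) = u ^ (m\<^sup>2 - 1) * u"
        unfolding F_def norm_power u_def by (metis power_Suc2)
      also have "\<dots> \<le> 2 ^ (m\<^sup>2 - 1) * (16 * min ((1 - \<alpha> k) / norm (1 - z)) (norm (1 - z) / (1 - \<alpha> k)))"
        using norm_peak_le[OF \<alpha> z1] unfolding u_def by (intro mult_mono power_mono) auto
      finally show ?thesis by (simp only: mult.assoc)
    qed
    have "(\<Sum>k\<in>S. norm (F k z)) \<le> (\<Sum>k\<in>S. 2 ^ (m\<^sup>2 - 1) * 16 *
        min ((1 - \<alpha> k) / norm (1 - z)) (norm (1 - z) / (1 - \<alpha> k)))"
      by (rule sum_mono) (rule Fle)
    also have "\<dots> \<le> M"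
      unfolding sum_distrib_left[symmetric] M_def
      by (intro mult_left_mono sum_min_ratio_le[OF S d]) auto
    finally show ?thesis .
  qed
  obtain C where C: "\<And>f. f \<in> Hinf \<Longrightarrow> Hinf_norm (volterra B f) \<le> C * Hinf_norm f"
    and T: "\<And>f. f \<in> Hinf \<Longrightarrow> volterra B f \<in> Hinf"
    using bounded unfolding bounded_on_Hinf_def B_def by blast
  have bound: "real (card S) * c \<le> \<bar>C\<bar> * M" if S: "finite S" "S \<subseteq> {k. 1/2 \<le> \<alpha> k}" for S
  proof -
    \<comment> \<open>The finitely many peaks of \<open>S\<close> share one upper limit of integration; the entry 0 covers empty \<open>S\<close>.\<close>
    define \<rho> where "\<rho> = Max (insert 0 ((\<lambda>k. (1 + 2 * \<alpha> k) / (2 + \<alpha> k)) ` S))"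
    have \<rho>ge: "(1 + 2 * \<alpha> k) / (2 + \<alpha> k) \<le> \<rho>" if "k \<in> S" for k
      unfolding \<rho>_def using S(1) that by (intro Max_ge) auto
    have \<rho>0: "0 \<le> \<rho>" unfolding \<rho>_def using S(1) by (intro Max_ge) auto
    have "(1 + 2 * \<alpha> k) / (2 + \<alpha> k) < 1" for k using \<alpha>[of k] by simp
    then have \<rho>1: "\<rho> < 1" unfolding \<rho>_def using S(1) by (subst Max_less_iff) auto
    have \<rho>ball: "of_real \<rho> \<in> ball (0::complex) 1" using \<rho>0 \<rho>1 by simp
    define I where "I k = contour_integral (linepath 0 (of_real \<rho>)) (\<lambda>z. F k z * deriv B z)" for k
    have Ige: "c \<le> norm (I k)" if "k \<in> S" for k
    proof -
      have "c \<le> (1 - (\<alpha> k)\<^sup>2) * norm (deriv B (of_real (\<alpha> k))) * 4 / (3 * real m) - 8 / (real m ^ 2 - 1)"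
        unfolding c_def using derB[of k] by (intro diff_right_mono divide_right_mono mult_right_mono) auto
      also have "\<dots> \<le> norm (I k)"
        unfolding I_def F_def
        by (rule peak_integral_ge[OF _ \<alpha>(2) \<rho>ge[OF that] \<rho>1 holB bdB m2]) (use S(2) that in auto)
      finally show ?thesis .
    qed
    \<comment> \<open>If \<open>I k = 0\<close>, division by zero makes \<open>e k = 0\<close>, and both \<open>e1\<close> and \<open>eI\<close> still hold.\<close>
    define e where "e k = cnj (I k) / of_real (norm (I k))" for k
    have e1: "norm (e k) \<le> 1" for k by (simp add: e_def norm_divide)
    have eI: "e k * I k = of_real (norm (I k))" for k
    proof (cases "I k = 0")
      case False
      have "cnj (I k) * I k = of_real (norm (I k)) * of_real (norm (I k))"
        by (metis complex_norm_square mult.commute of_real_mult power2_eq_square)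
      then show ?thesis using False by (simp add: e_def)
    qed (simp add: e_def)
    define f where "f z = (\<Sum>k\<in>S. e k * F k z)" for z
    have f: "f \<in> Hinf" "Hinf_norm f \<le> M"
    proof -
      have hol: "f holomorphic_on ball 0 1"
        unfolding f_def by (intro holomorphic_intros holF)
      have le: "norm (f z) \<le> M" if "z \<in> ball 0 1" for z
      proof -
        have "norm (f z) \<le> (\<Sum>k\<in>S. norm (e k) * norm (F k z))"
          unfolding f_def by (rule order_trans[OF norm_sum]) (simp add: norm_mult)
        also have "\<dots> \<le> (\<Sum>k\<in>S. norm (F k z))"
          using e1 by (intro sum_mono mult_left_le_one_le) auto
        also have "\<dots> \<le> M" by (rule sumF[OF S(1) that])
        finally show ?thesis .
      qed
      show "f \<in> Hinf" "Hinf_norm f \<le> M" using HinfI[of f M] hol le by auto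
    qed
    have int: "(\<lambda>z. F k z * deriv B z) contour_integrable_on linepath 0 (of_real \<rho>)" for k
    proof (rule contour_integrable_holomorphic_simple[OF _ open_ball])
      show "(\<lambda>z. F k z * deriv B z) holomorphic_on ball 0 1"
        using holF holB by (intro holomorphic_intros holomorphic_deriv) auto
      show "path_image (linepath 0 (of_real \<rho>)) \<subseteq> ball (0::complex) 1"
        using \<rho>ball by (simp add: closed_segment_subset)
    qed simp
    have "volterra B f (of_real \<rho>) =
        contour_integral (linepath 0 (of_real \<rho>)) (\<lambda>z. \<Sum>k\<in>S. e k * (F k z * deriv B z))"
      unfolding volterra_def f_def sum_distrib_right mult.assoc ..
    also have "\<dots> = (\<Sum>k\<in>S. e k * I k)"
      unfolding I_def using S(1) int
      by (simp add: contour_integral_sum contour_integral_lmul contour_integrable_lmul)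
    finally have V: "volterra B f (of_real \<rho>) = of_real (\<Sum>k\<in>S. norm (I k))" by (simp add: eI)
    have "real (card S) * c \<le> (\<Sum>k\<in>S. norm (I k))"
      using sum_mono[of S "\<lambda>_. c" "\<lambda>k. norm (I k)"] Ige by simp
    also have "\<dots> = norm (volterra B f (of_real \<rho>))"
      unfolding V norm_of_real by (intro abs_of_nonneg[symmetric] sum_nonneg) auto
    also have "\<dots> \<le> Hinf_norm (volterra B f)" by (rule norm_le_Hinf_norm[OF T[OF f(1)] \<rho>ball])
    also have "\<dots> \<le> C * Hinf_norm f" by (rule C[OF f(1)])
    also have "\<dots> \<le> \<bar>C\<bar> * M"
    proof -
      have "0 \<le> norm (f 0)" by simp
      also have "\<dots> \<le> Hinf_norm f" by (rule norm_le_Hinf_norm[OF f(1)]) simp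
      finally show ?thesis using f(2) by (intro mult_mono) auto
    qed
    finally show ?thesis .
  qed
  have "infinite {k. 1/2 \<le> \<alpha> k}"
  proof -
    have "(\<lambda>j. 1 - \<alpha> j) \<longlonglongrightarrow> 0" using sum by (rule summable_LIMSEQ_zero)
    then have "\<forall>\<^sub>F j in sequentially. 1 - \<alpha> j < 1/2" by (rule order_tendstoD(2)) simp
    then obtain N where "\<And>j. j \<ge> N \<Longrightarrow> 1 - \<alpha> j < 1/2" by (auto simp: eventually_sequentially)
    then have "{N..} \<subseteq> {k. 1/2 \<le> \<alpha> k}" by (force intro: less_imp_le)
    then show ?thesis using infinite_Ici infinite_super by blast
  qed
  moreover obtain n :: nat where "\<bar>C\<bar> * M / c < real n" using reals_Archimedean2 by blast
  ultimately obtain S where "S \<subseteq> {k. 1/2 \<le> \<alpha> k}" "finite S" "card S = n"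
    by (meson infinite_arbitrarily_large)
  then have "real n * c \<le> \<bar>C\<bar> * M" using bound by blast
  then show False using \<open>\<bar>C\<bar> * M / c < real n\<close> c by (simp add: divide_less_eq)
qed

end
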